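(* Let $\alpha_1,\alpha_2$ be real numbers such that $1,\alpha_1,\alpha_2$ are linearly independent over $\mathbb{Z}$, and let $(\mathbf m_\nu)_{\nu\geqslant1}$, $\mathbf m_\nu=(m_{0,\nu},m_{1,\nu},m_{2,\nu})$, be the sequence of best approximations with associated quantities $M_\nu,\zeta_\nu$ (defined in the context). Let $\nu\geqslant 2$ be such that $$\det\begin{pmatrix} m_{0,\nu-1}&m_{1,\nu-1}&m_{2,\nu-1}\\ m_{0,\nu}&m_{1,\nu}&m_{2,\nu}\\ m_{0,\nu+1}&m_{1,\nu+1}&m_{2,\nu+1}\end{pmatrix}\neq 0.$$ Then at least one of the following two statements holds. (i) There exists an integer point $(x_1^0,x_2^0)$ such that $x_1^0,x_2^0>0$; $M_{\nu+2}\leqslant\max\{x_1^0,x_2^0\}\leqslant 4M_{\nu+2}$; and $\|\alpha_1x_1^0+\alpha_2x_2^0\|\leqslant 16(\max\{x_1^0,x_2^0\})^{-2}$. (ii) There exists an integer point $(x_1^0,x_2^0)$ such that $x_1^0,x_2^0>0$; $\max\{x_1^0,x_2^0\}\leqslant 240\,M_{\nu+1}^{\tau}M_\nu^{-1/\tau}$; and $\|\alpha_1x_1^0+\alpha_2x_2^0\|\leqslant 24^{\tau}M_\nu^{\frac{1-\tau}{\tau}}(\max\{x_1^0,x_2^0\})^{-\tau}$, where $\tau=\frac{1+\sqrt5}{2}$.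
   Context: For real $\xi$, $\|\xi\|$ is the distance from $\xi$ to the nearest integer. For $\mathbf m=(m_0,m_1,m_2)\in\mathbb Z^3$ put $\zeta(\mathbf m)=m_0+m_1\alpha_1+m_2\alpha_2$. A point $\mathbf m\in\mathbb Z^3\setminus\{0\}$ is a best approximation (in the sense of the linear form) if $|\zeta(\mathbf m)|=\|m_1\alpha_1+m_2\alpha_2\|$ and $\|m_1\alpha_1+m_2\alpha_2\|\leqslant\|n_1\alpha_1+n_2\alpha_2\|$ for all $(n_1,n_2)\in\mathbb Z^2$ with $0<\max(|n_1|,|n_2|)\leqslant\max(|m_1|,|m_2|)$. Identifying $\mathbf m$ with $-\mathbf m$, the best approximations form a sequence $\mathbf m_\nu$, $\nu=1,2,\dots$, ordered so that $M_\nu=\max(|m_{1,\nu}|,|m_{2,\nu}|)$ is strictly increasing; then $\zeta_\nu=|\zeta(\mathbf m_\nu)|=\|m_{1,\nu}\alpha_1+m_{2,\nu}\alpha_2\|$ is strictly decreasing. *)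

theory Defs
  imports "HOL-Analysis.Analysis"
begin

definition dist_nearest_int :: "real \<Rightarrow> real" where
  "dist_nearest_int \<xi> = \<bar>\<xi> - of_int (round \<xi>)\<bar>"

definition lin_indep_Z3 :: "real \<Rightarrow> real \<Rightarrow> real \<Rightarrow> bool" where
  "lin_indep_Z3 x y z \<longleftrightarrow>
     (\<forall>a b c :: int. of_int a * x + of_int b * y + of_int c * z = 0 \<longrightarrow> a = 0 \<and> b = 0 \<and> c = 0)"

(* The coordinates m_0, m_1, m_2 of an integer point m are m $ 1, m $ 2, m $ 3. *)

definition linear_form :: "real \<Rightarrow> real \<Rightarrow> int ^ 3 \<Rightarrow> real" where
  "linear_form \<alpha>\<^sub>1 \<alpha>\<^sub>2 m = of_int (m $ 1) + of_int (m $ 2) * \<alpha>\<^sub>1 + of_int (m $ 3) * \<alpha>\<^sub>2"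

(* The size M of an integer point does not involve m_0. *)

definition height :: "int ^ 3 \<Rightarrow> int" where
  "height m = max \<bar>m $ 2\<bar> \<bar>m $ 3\<bar>"

definition best_approximation :: "real \<Rightarrow> real \<Rightarrow> int ^ 3 \<Rightarrow> bool" where
  "best_approximation \<alpha>\<^sub>1 \<alpha>\<^sub>2 m \<longleftrightarrow>
     m \<noteq> 0 \<and>
     \<bar>linear_form \<alpha>\<^sub>1 \<alpha>\<^sub>2 m\<bar> = dist_nearest_int (of_int (m $ 2) * \<alpha>\<^sub>1 + of_int (m $ 3) * \<alpha>\<^sub>2) \<and>
     (\<forall>n\<^sub>1 n\<^sub>2 :: int. 0 < max \<bar>n\<^sub>1\<bar> \<bar>n\<^sub>2\<bar> \<and> max \<bar>n\<^sub>1\<bar> \<bar>n\<^sub>2\<bar> \<le> max \<bar>m $ 2\<bar> \<bar>m $ 3\<bar> \<longrightarrow>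
        dist_nearest_int (of_int (m $ 2) * \<alpha>\<^sub>1 + of_int (m $ 3) * \<alpha>\<^sub>2)
          \<le> dist_nearest_int (of_int n\<^sub>1 * \<alpha>\<^sub>1 + of_int n\<^sub>2 * \<alpha>\<^sub>2))"

(* The sequence is indexed by \<nu> \<ge> 1, so m 0 is irrelevant. It lists every best
   approximation exactly once up to sign; the choice of sign is arbitrary. *)

definition best_approximation_seq :: "real \<Rightarrow> real \<Rightarrow> (nat \<Rightarrow> int ^ 3) \<Rightarrow> bool" where
  "best_approximation_seq \<alpha>\<^sub>1 \<alpha>\<^sub>2 m \<longleftrightarrow>
     (\<forall>\<nu>\<ge>1. best_approximation \<alpha>\<^sub>1 \<alpha>\<^sub>2 (m \<nu>)) \<and>
     (\<forall>n. best_approximation \<alpha>\<^sub>1 \<alpha>\<^sub>2 n \<longrightarrow> (\<exists>\<nu>\<ge>1. n = m \<nu> \<or> n = - m \<nu>)) \<and>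
     (\<forall>\<nu>\<ge>1. height (m \<nu>) < height (m (Suc \<nu>)))"

definition golden_ratio :: real where
  "golden_ratio = (1 + sqrt 5) / 2"

end

theory Submission
  imports Defs
begin

text \<open>
The point constructed is always as in (ii). Let \<open>p, q, r\<close> be \<open>\<^bold>m\<close> at \<open>\<nu> - 1, \<nu>, \<nu> + 1\<close>, let
\<open>a < b\<close> be the heights of \<open>q\<close> and \<open>r\<close>, \<open>t = b / a\<close> and \<open>s = a\<^sup>2 \<bar>\<zeta>(q)\<bar>\<close>; by Dirichlet
\<open>s \<le> t powi (-2)\<close>. For (ii) it suffices to find a positive point of size \<open>X \<le> K a\<close> and form at most
\<open>E / a\<^sup>2\<close> with \<open>E K powr \<tau> \<le> 24 powr \<tau>\<close> and \<open>K \<le> 240 t powr \<tau>\<close>.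

If \<open>t \<le> 10\<close>, round a real positive point on the plane \<open>\<zeta> = 0\<close> to the lattice spanned by
\<open>p, q, r\<close>. Otherwise the two-dimensional determinant \<open>D\<close> of \<open>q, r\<close> is at least \<open>3 a\<^sup>2 / 5\<close>.
If \<open>s t powr (1 + \<tau>) \<le> 1\<close>, take a positive combination of \<open>q\<close> and \<open>r\<close>, found by rounding with respect to a
reduced basis: it has \<open>K = O(t)\<close> and \<open>E = O(t s)\<close>. If \<open>s t powr (1 + \<tau>) \<ge> 1\<close>, leave the plane of
\<open>q, r\<close>: on an integer level of \<open>det (\<sqdot>, q, r)\<close> the line \<open>\<zeta> = 0\<close> crosses the positive quadrant at
distance about \<open>1 / (b \<bar>\<zeta>(q)\<bar>)\<close>, so rounding there gives \<open>K = O(1 / (t s))\<close> and \<open>E = s\<close>. Since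
\<open>\<tau>\<^sup>2 = \<tau> + 1\<close>, the same threshold on \<open>s\<close> works for both constructions.
\<close>

subsection \<open>Rounding to lattice points\<close>

lemma round_error:
  fixes x :: real
  obtains i :: int and \<delta> where "\<bar>\<delta>\<bar> \<le> 1/2" "of_int i = x + \<delta>"
  using of_int_round_abs_le[of x] by (metis diff_add_cancel add.commute)

text \<open>Cramer's rule gives the real coordinates of \<open>y\<close> in the basis, and each is
  rounded separately. The error stays expressed through the basis vectors, so one pair
  \<open>\<delta>\<close>, \<open>\<epsilon>\<close> controls both coordinates and also any linear
  form.\<close>

lemma lattice_cover_2:
  fixes q\<^sub>1 q\<^sub>2 r\<^sub>1 r\<^sub>2 y\<^sub>1 y\<^sub>2 :: real
  assumes "q\<^sub>1 * r\<^sub>2 - q\<^sub>2 * r\<^sub>1 \<noteq> 0"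
  obtains i j :: int and \<delta> \<epsilon> :: real where
    "\<bar>\<delta>\<bar> \<le> 1/2" "\<bar>\<epsilon>\<bar> \<le> 1/2"
    "i * q\<^sub>1 + j * r\<^sub>1 = y\<^sub>1 + \<delta> * q\<^sub>1 + \<epsilon> * r\<^sub>1"
    "i * q\<^sub>2 + j * r\<^sub>2 = y\<^sub>2 + \<delta> * q\<^sub>2 + \<epsilon> * r\<^sub>2"
proof -
  define D where "D = q\<^sub>1 * r\<^sub>2 - q\<^sub>2 * r\<^sub>1"
  define \<beta> where "\<beta> = (y\<^sub>1 * r\<^sub>2 - y\<^sub>2 * r\<^sub>1) / D"
  define \<gamma> where "\<gamma> = (q\<^sub>1 * y\<^sub>2 - q\<^sub>2 * y\<^sub>1) / D"
  have D: "D \<noteq> 0" using assms by (simp add: D_def)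
  have "\<beta> * q\<^sub>1 + \<gamma> * r\<^sub>1 = (y\<^sub>1 * D) / D" "\<beta> * q\<^sub>2 + \<gamma> * r\<^sub>2 = (y\<^sub>2 * D) / D"
    unfolding \<beta>_def \<gamma>_def times_divide_eq_left add_divide_distrib [symmetric]
    by (simp_all add: D_def algebra_simps)
  then have eq: "\<beta> * q\<^sub>1 + \<gamma> * r\<^sub>1 = y\<^sub>1" "\<beta> * q\<^sub>2 + \<gamma> * r\<^sub>2 = y\<^sub>2" using D by auto
  obtain i \<delta> where i: "\<bar>\<delta>\<bar> \<le> 1/2" "of_int i = \<beta> + \<delta>" by (rule round_error)
  obtain j \<epsilon> where j: "\<bar>\<epsilon>\<bar> \<le> 1/2" "of_int j = \<gamma> + \<epsilon>" by (rule round_error)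
  show thesis
    by (rule that[OF i(1) j(1), of i j]) (use eq in \<open>simp_all add: i j algebra_simps\<close>)
qed

text \<open>The first coordinate will hold values of the linear form, hence real rather than
  integral entries.\<close>

lemma lattice_cover_3:
  fixes p\<^sub>1 p\<^sub>2 p\<^sub>3 q\<^sub>1 q\<^sub>2 q\<^sub>3 r\<^sub>1 r\<^sub>2 r\<^sub>3 y\<^sub>1 y\<^sub>2 y\<^sub>3 :: real
  assumes "p\<^sub>1 * (q\<^sub>2 * r\<^sub>3 - q\<^sub>3 * r\<^sub>2) - p\<^sub>2 * (q\<^sub>1 * r\<^sub>3 - q\<^sub>3 * r\<^sub>1) + p\<^sub>3 * (q\<^sub>1 * r\<^sub>2 - q\<^sub>2 * r\<^sub>1) \<noteq> 0"
  obtains i j k :: int and \<delta> \<epsilon> \<theta> :: real where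
    "\<bar>\<delta>\<bar> \<le> 1/2" "\<bar>\<epsilon>\<bar> \<le> 1/2" "\<bar>\<theta>\<bar> \<le> 1/2"
    "i * p\<^sub>1 + j * q\<^sub>1 + k * r\<^sub>1 = y\<^sub>1 + \<delta> * p\<^sub>1 + \<epsilon> * q\<^sub>1 + \<theta> * r\<^sub>1"
    "i * p\<^sub>2 + j * q\<^sub>2 + k * r\<^sub>2 = y\<^sub>2 + \<delta> * p\<^sub>2 + \<epsilon> * q\<^sub>2 + \<theta> * r\<^sub>2"
    "i * p\<^sub>3 + j * q\<^sub>3 + k * r\<^sub>3 = y\<^sub>3 + \<delta> * p\<^sub>3 + \<epsilon> * q\<^sub>3 + \<theta> * r\<^sub>3"
proof -
  define D where "D = p\<^sub>1 * (q\<^sub>2 * r\<^sub>3 - q\<^sub>3 * r\<^sub>2) - p\<^sub>2 * (q\<^sub>1 * r\<^sub>3 - q\<^sub>3 * r\<^sub>1) + p\<^sub>3 * (q\<^sub>1 * r\<^sub>2 - q\<^sub>2 * r\<^sub>1)"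
  define \<beta> where "\<beta> = (y\<^sub>1 * (q\<^sub>2 * r\<^sub>3 - q\<^sub>3 * r\<^sub>2) - y\<^sub>2 * (q\<^sub>1 * r\<^sub>3 - q\<^sub>3 * r\<^sub>1) + y\<^sub>3 * (q\<^sub>1 * r\<^sub>2 - q\<^sub>2 * r\<^sub>1)) / D"
  define \<gamma> where "\<gamma> = (p\<^sub>1 * (y\<^sub>2 * r\<^sub>3 - y\<^sub>3 * r\<^sub>2) - p\<^sub>2 * (y\<^sub>1 * r\<^sub>3 - y\<^sub>3 * r\<^sub>1) + p\<^sub>3 * (y\<^sub>1 * r\<^sub>2 - y\<^sub>2 * r\<^sub>1)) / D"
  define \<kappa> where "\<kappa> = (p\<^sub>1 * (q\<^sub>2 * y\<^sub>3 - q\<^sub>3 * y\<^sub>2) - p\<^sub>2 * (q\<^sub>1 * y\<^sub>3 - q\<^sub>3 * y\<^sub>1) + p\<^sub>3 * (q\<^sub>1 * y\<^sub>2 - q\<^sub>2 * y\<^sub>1)) / D"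
  have D: "D \<noteq> 0" using assms by (simp add: D_def)
  have "\<beta> * p\<^sub>1 + \<gamma> * q\<^sub>1 + \<kappa> * r\<^sub>1 = (y\<^sub>1 * D) / D" "\<beta> * p\<^sub>2 + \<gamma> * q\<^sub>2 + \<kappa> * r\<^sub>2 = (y\<^sub>2 * D) / D"
    "\<beta> * p\<^sub>3 + \<gamma> * q\<^sub>3 + \<kappa> * r\<^sub>3 = (y\<^sub>3 * D) / D"
    unfolding \<beta>_def \<gamma>_def \<kappa>_def times_divide_eq_left add_divide_distrib [symmetric]
    by (rule arg_cong[where f = "\<lambda>u. u / D"], simp add: D_def algebra_simps)+
  then have eq: "\<beta> * p\<^sub>1 + \<gamma> * q\<^sub>1 + \<kappa> * r\<^sub>1 = y\<^sub>1" "\<beta> * p\<^sub>2 + \<gamma> * q\<^sub>2 + \<kappa> * r\<^sub>2 = y\<^sub>2"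
    "\<beta> * p\<^sub>3 + \<gamma> * q\<^sub>3 + \<kappa> * r\<^sub>3 = y\<^sub>3" using D by auto
  obtain i \<delta> where i: "\<bar>\<delta>\<bar> \<le> 1/2" "of_int i = \<beta> + \<delta>" by (rule round_error)
  obtain j \<epsilon> where j: "\<bar>\<epsilon>\<bar> \<le> 1/2" "of_int j = \<gamma> + \<epsilon>" by (rule round_error)
  obtain k \<theta> where k: "\<bar>\<theta>\<bar> \<le> 1/2" "of_int k = \<kappa> + \<theta>" by (rule round_error)
  show thesis
    by (rule that[OF i(1) j(1) k(1), of i j k]) (use eq in \<open>simp_all add: i j k algebra_simps\<close>)
qed

lemma abs_mult_half: "\<bar>e * x\<bar> \<le> y / 2" if "\<bar>e\<bar> \<le> 1/2" "\<bar>x\<bar> \<le> y" for e x y :: real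
  using mult_mono[of "\<bar>e\<bar>" "1/2" "\<bar>x\<bar>" y] that by (simp add: abs_mult)

text \<open>Since \<open>r\<close> may be much longer than \<open>q\<close>, it is replaced by
  \<open>r - k q\<close>, which is at most \<open>a / 2\<close> in the coordinate where
  \<open>q\<close> attains its maximum; the determinant then controls the other coordinate. So the
  bound does not involve the size of \<open>r\<close>.\<close>

lemma lattice_cover_reduced:
  fixes q\<^sub>1 q\<^sub>2 r\<^sub>1 r\<^sub>2 a :: real
  defines "D \<equiv> q\<^sub>1 * r\<^sub>2 - q\<^sub>2 * r\<^sub>1"
  assumes D: "D \<noteq> 0" and a: "0 < a" and q: "max \<bar>q\<^sub>1\<bar> \<bar>q\<^sub>2\<bar> = a"
  obtains i j :: int where "0 < i * q\<^sub>1 + j * r\<^sub>1" "0 < i * q\<^sub>2 + j * r\<^sub>2"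
    "i * q\<^sub>1 + j * r\<^sub>1 \<le> 7/4 * a + \<bar>D\<bar> / a" "i * q\<^sub>2 + j * r\<^sub>2 \<le> 7/4 * a + \<bar>D\<bar> / a"
proof -
  have main: "\<exists>(i :: int) (j :: int). 0 < i * q\<^sub>1 + j * r\<^sub>1 \<and> 0 < i * q\<^sub>2 + j * r\<^sub>2 \<and>
      i * q\<^sub>1 + j * r\<^sub>1 \<le> 7/4 * a + \<bar>E\<bar> / a \<and> i * q\<^sub>2 + j * r\<^sub>2 \<le> 7/4 * a + \<bar>E\<bar> / a"
    if E: "E = q\<^sub>1 * r\<^sub>2 - q\<^sub>2 * r\<^sub>1" "E \<noteq> 0" and q: "\<bar>q\<^sub>1\<bar> = a" "\<bar>q\<^sub>2\<bar> \<le> a"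
    for q\<^sub>1 q\<^sub>2 r\<^sub>1 r\<^sub>2 E :: real
  proof -
    obtain k \<eta> where k: "\<bar>\<eta>\<bar> \<le> 1/2" "real_of_int k = r\<^sub>1 / q\<^sub>1 + \<eta>" by (rule round_error)
    define u\<^sub>1 where "u\<^sub>1 = r\<^sub>1 - k * q\<^sub>1"
    define u\<^sub>2 where "u\<^sub>2 = r\<^sub>2 - k * q\<^sub>2"
    have "u\<^sub>1 = - \<eta> * q\<^sub>1" using k(2) q a by (auto simp: u\<^sub>1_def field_simps)
    then have u1: "\<bar>u\<^sub>1\<bar> \<le> a / 2" using k(1) q(1) mult_right_mono[OF k(1), of a] a
      by (simp add: abs_mult)
    have Eu: "E = q\<^sub>1 * u\<^sub>2 - q\<^sub>2 * u\<^sub>1" by (simp add: E u\<^sub>1_def u\<^sub>2_def algebra_simps)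
    have "a * \<bar>u\<^sub>2\<bar> = \<bar>E + q\<^sub>2 * u\<^sub>1\<bar>" by (simp add: Eu abs_mult q(1))
    also have "\<dots> \<le> \<bar>E\<bar> + \<bar>q\<^sub>2\<bar> * \<bar>u\<^sub>1\<bar>" by (metis abs_mult abs_triangle_ineq)
    also have "\<dots> \<le> \<bar>E\<bar> + a * (a / 2)" using q(2) u1 a by (intro add_left_mono mult_mono) auto
    also have "\<dots> = a * (\<bar>E\<bar> / a + a / 2)" using a by (simp add: field_simps)
    finally have u2: "\<bar>u\<^sub>2\<bar> \<le> \<bar>E\<bar> / a + a / 2" using a by simp
    \<comment> \<open>The rounding errors in the two coordinates are at most 3a/4 and 3a/4 +
      |E|/(2a); both are below \<open>w\<close>.\<close>
    define w where "w = a + \<bar>E\<bar> / a / 2"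
    have nz: "q\<^sub>1 * u\<^sub>2 - q\<^sub>2 * u\<^sub>1 \<noteq> 0" using E(2) Eu by simp
    obtain i j :: int and \<delta> \<epsilon> :: real where ij: "\<bar>\<delta>\<bar> \<le> 1/2" "\<bar>\<epsilon>\<bar> \<le> 1/2"
      "i * q\<^sub>1 + j * u\<^sub>1 = w + \<delta> * q\<^sub>1 + \<epsilon> * u\<^sub>1"
      "i * q\<^sub>2 + j * u\<^sub>2 = w + \<delta> * q\<^sub>2 + \<epsilon> * u\<^sub>2"
      by (rule lattice_cover_2[OF nz])
    have "0 \<le> \<bar>E\<bar> / a" using a by simp
    moreover have "\<bar>q\<^sub>1\<bar> \<le> a" using q by simp
    note abs_mult_half[OF ij(1) this] abs_mult_half[OF ij(1) q(2)]
      abs_mult_half[OF ij(2) u1] abs_mult_half[OF ij(2) u2]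
    ultimately have "0 < i * q\<^sub>1 + j * u\<^sub>1 \<and> 0 < i * q\<^sub>2 + j * u\<^sub>2 \<and>
      i * q\<^sub>1 + j * u\<^sub>1 \<le> 7/4 * a + \<bar>E\<bar> / a \<and> i * q\<^sub>2 + j * u\<^sub>2 \<le> 7/4 * a + \<bar>E\<bar> / a"
      unfolding ij(3,4) w_def abs_le_iff using a by argo
    moreover have "i * q\<^sub>1 + j * u\<^sub>1 = of_int (i - j * k) * q\<^sub>1 + j * r\<^sub>1"
      "i * q\<^sub>2 + j * u\<^sub>2 = of_int (i - j * k) * q\<^sub>2 + j * r\<^sub>2"
      by (simp_all add: u\<^sub>1_def u\<^sub>2_def algebra_simps)
    ultimately show ?thesis by metis
  qed
  show thesis
  proof (cases "\<bar>q\<^sub>1\<bar> = a")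
    case True
    moreover have "\<bar>q\<^sub>2\<bar> \<le> a" using q by linarith
    ultimately show thesis using main[OF meta_eq_to_obj_eq[OF D_def] D] that by blast
  next
    case False
    then have "\<bar>q\<^sub>2\<bar> = a" "\<bar>q\<^sub>1\<bar> \<le> a" using q by linarith+
    \<comment> \<open>Exchanging the two coordinates reverses the sign of the determinant.\<close>
    moreover have "- D = q\<^sub>2 * r\<^sub>1 - q\<^sub>1 * r\<^sub>2" "- D \<noteq> 0" using D by (simp_all add: D_def)
    ultimately have "\<exists>(i :: int) (j :: int). 0 < i * q\<^sub>2 + j * r\<^sub>2 \<and> 0 < i * q\<^sub>1 + j * r\<^sub>1 \<and>
      i * q\<^sub>2 + j * r\<^sub>2 \<le> 7/4 * a + \<bar>- D\<bar> / a \<and> i * q\<^sub>1 + j * r\<^sub>1 \<le> 7/4 * a + \<bar>- D\<bar> / a"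
      by (intro main)
    then show thesis using that unfolding abs_minus_cancel by blast
  qed
qed

subsection \<open>Golden ratio exponents\<close>

lemma golden_ratio_facts:
  shows golden_ratio_sq: "golden_ratio * golden_ratio = golden_ratio + 1"
    and golden_ratio_gt: "3/2 < golden_ratio"
proof -
  have "2 < sqrt 5" by (simp add: real_less_rsqrt)
  then show "3/2 < golden_ratio" by (simp add: golden_ratio_def)
  have "sqrt 5 * sqrt 5 = (5::real)" by simp
  then show "golden_ratio * golden_ratio = golden_ratio + 1"
    by (simp add: golden_ratio_def field_simps)
qed

lemma golden_exponents:
  shows "- 1 / golden_ratio = 1 - golden_ratio"
    and "(1 - golden_ratio) / golden_ratio = golden_ratio - 2"
  using golden_ratio_facts by (simp_all add: field_simps)

text \<open>Rescales by \<open>a\<close>. By \<open>golden_exponents\<close> the two targets are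
  \<open>240 * a * (b / a) powr \<tau>\<close> and
  \<open>24 powr \<tau> * (X / a) powr (-\<tau>) / a^2\<close>, so only \<open>K\<close> and
  \<open>E\<close> matter.\<close>

lemma golden_bounds:
  fixes a b X \<delta> K E :: real
  assumes "0 < a" "0 < b" "0 < X" "0 < K" "0 \<le> E"
    and X: "X \<le> K * a" and \<delta>: "\<delta> * a\<^sup>2 \<le> E"
    and EK: "E * K powr golden_ratio \<le> 24 powr golden_ratio"
    and K: "K \<le> 240 * (b / a) powr golden_ratio"
  shows "X \<le> 240 * b powr golden_ratio * a powr (- 1 / golden_ratio) \<and>
    \<delta> \<le> 24 powr golden_ratio * a powr ((1 - golden_ratio) / golden_ratio) * X powr (- golden_ratio)"
proof
  let ?t = golden_ratio
  have "X \<le> 240 * (b / a) powr ?t * a"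
    using X mult_right_mono[OF K, of a] \<open>0 < a\<close> by linarith
  also have "\<dots> = 240 * b powr ?t * a powr (1 - ?t)"
    using \<open>0 < a\<close> \<open>0 < b\<close> by (simp add: powr_divide powr_diff)
  finally show "X \<le> 240 * b powr ?t * a powr (- 1 / ?t)"
    unfolding golden_exponents .
  have "\<delta> \<le> E / a\<^sup>2"
    using \<delta> \<open>0 < a\<close> by (simp add: field_simps)
  also have "E \<le> 24 powr ?t * K powr (- ?t)"
    using EK \<open>0 < K\<close> by (simp add: powr_minus field_simps)
  also have "24 powr ?t * K powr (- ?t) / a\<^sup>2 = 24 powr ?t * a powr (?t - 2) * (K * a) powr (- ?t)"
    using \<open>0 < a\<close> \<open>0 < K\<close> by (simp add: powr_mult powr_diff powr_minus field_simps)
  also have "\<dots> \<le> 24 powr ?t * a powr (?t - 2) * X powr (- ?t)"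
    using X \<open>0 < X\<close> golden_ratio_gt by (intro mult_left_mono powr_mono2') auto
  finally show "\<delta> \<le> 24 powr ?t * a powr ((1 - ?t) / ?t) * X powr (- ?t)"
    using \<open>0 < a\<close> unfolding golden_exponents by (simp add: divide_right_mono)
qed

subsection \<open>Best approximations\<close>

lemma abs_component_le_height:
  shows "\<bar>real_of_int (x $ 2)\<bar> \<le> height x" "\<bar>real_of_int (x $ 3)\<bar> \<le> height x"
  by (auto simp: height_def)

lemma height_nonneg: "0 \<le> height x" by (auto simp: height_def)

lemma linear_form_add: "linear_form \<alpha> \<beta> (x + y) = linear_form \<alpha> \<beta> x + linear_form \<alpha> \<beta> y"
  by (simp add: linear_form_def algebra_simps)

lemma linear_form_scale: "linear_form \<alpha> \<beta> (k *s x) = of_int k * linear_form \<alpha> \<beta> x"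
  by (simp add: linear_form_def algebra_simps)

lemma linear_form_minus: "linear_form \<alpha> \<beta> (- x) = - linear_form \<alpha> \<beta> x"
  by (simp add: linear_form_def algebra_simps)

lemma dist_nearest_int_le_linear_form:
  "dist_nearest_int (of_int (x $ 2) * \<alpha> + of_int (x $ 3) * \<beta>) \<le> \<bar>linear_form \<alpha> \<beta> x\<bar>"
  using round_diff_minimal[of "of_int (x $ 2) * \<alpha> + of_int (x $ 3) * \<beta>" "- (x $ 1)"]
  by (simp add: dist_nearest_int_def linear_form_def add.commute add.left_commute)

text \<open>Adding \<alpha> times the second column and \<beta> times the third to the first turns
  the first column into values of the form; then expand along the row of \<open>p\<close>.\<close>

lemma det_eq_linear_form:
  fixes \<alpha> \<beta> :: real and p q r :: "int ^ 3"
  defines "\<zeta> \<equiv> linear_form \<alpha> \<beta>"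
  shows "of_int (det (vector [p, q, r] :: int ^ 3 ^ 3)) =
    \<zeta> p * (of_int (q $ 2) * of_int (r $ 3) - of_int (q $ 3) * of_int (r $ 2)) -
    of_int (p $ 2) * (\<zeta> q * of_int (r $ 3) - of_int (q $ 3) * \<zeta> r) +
    of_int (p $ 3) * (\<zeta> q * of_int (r $ 2) - of_int (q $ 2) * \<zeta> r)"
  by (simp add: det_3 \<zeta>_def linear_form_def algebra_simps)

section \<open>Dirichlet's theorem for a linear form in two variables\<close>

lemma dist_nearest_int_le: "dist_nearest_int \<xi> \<le> \<bar>\<xi> - of_int k\<bar>"
  unfolding dist_nearest_int_def by (rule round_diff_minimal)

text \<open>Pigeonhole on pairs with entries in \<open>{0..<b}\<close>, sorted by the fractional
  part of \<open>L\<close> into \<open>b * b\<close> intervals of length \<open>1 / b^2\<close>.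
  There are only as many pairs as intervals, so a collision may fail to occur; then every interval
  is occupied, and a pair in the last one is within \<open>1 / b^2\<close> of the next
  integer.\<close>

lemma dirichlet_linear_form:
  fixes \<alpha> \<beta> :: real and b :: nat
  assumes b: "2 \<le> b"
  obtains n\<^sub>1 n\<^sub>2 :: int where "0 < max \<bar>n\<^sub>1\<bar> \<bar>n\<^sub>2\<bar>" "max \<bar>n\<^sub>1\<bar> \<bar>n\<^sub>2\<bar> < int b"
    "dist_nearest_int (of_int n\<^sub>1 * \<alpha> + of_int n\<^sub>2 * \<beta>) * (real b)\<^sup>2 \<le> 1"
proof -
  define L where "L = (\<lambda>(i, j). real i * \<alpha> + real j * \<beta>)"
  define f where "f = (\<lambda>z. nat \<lfloor>(real b)\<^sup>2 * frac (L z)\<rfloor>)"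
  define S where "S = {..<b} \<times> {..<b}"
  have b0: "(real b)\<^sup>2 > 0" using b by simp
  have range: "f ` S \<subseteq> {..<b * b}"
  proof
    fix y assume "y \<in> f ` S"
    then obtain z where y: "y = f z" by auto
    have "(real b)\<^sup>2 * frac (L z) < (real b)\<^sup>2 * 1"
      using b0 frac_lt_1 by (intro mult_strict_left_mono) auto
    then have "\<lfloor>(real b)\<^sup>2 * frac (L z)\<rfloor> < int (b * b)"
      by (simp add: floor_less_iff power2_eq_square)
    then show "y \<in> {..<b * b}" unfolding y f_def lessThan_iff
      using b by (subst nat_less_iff) auto
  qed
  have f_bounds: "of_int (int (f z)) \<le> (real b)\<^sup>2 * frac (L z)" "(real b)\<^sup>2 * frac (L z) < of_int (int (f z)) + 1" for z
  proof -
    have "0 \<le> (real b)\<^sup>2 * frac (L z)" by simp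
    then have "int (f z) = \<lfloor>(real b)\<^sup>2 * frac (L z)\<rfloor>" by (simp add: f_def)
    then show "of_int (int (f z)) \<le> (real b)\<^sup>2 * frac (L z)" "(real b)\<^sup>2 * frac (L z) < of_int (int (f z)) + 1"
      by linarith+
  qed
  show thesis
  proof (cases "inj_on f S")
    case True
    then have "card (f ` S) = b * b" by (simp add: card_image S_def)
    with range have "f ` S = {..<b * b}" by (intro card_subset_eq) auto
    moreover have "b * b - 1 \<in> {..<b * b}" using b by auto
    ultimately obtain z where z: "z \<in> S" "f z = b * b - 1" by (metis imageE)
    obtain i j where ij: "z = (i, j)" by (cases z)
    \<comment> \<open>The zero pair lies in the first interval, which is not the last because
      \<open>2 \<le> b\<close>.\<close>
    have "z \<noteq> (0, 0)"
    proof
      assume "z = (0, 0)"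
      then have "f z = 0" by (simp add: f_def L_def)
      moreover have "2 * 2 \<le> b * b" using b by (intro mult_mono) auto
      ultimately show False using z by simp
    qed
    have "real (f z) = (real b)\<^sup>2 - 1"
      using z b by (simp add: power2_eq_square of_nat_diff)
    with f_bounds(1)[of z] have "(1 - frac (L z)) * (real b)\<^sup>2 \<le> 1"
      by (simp add: algebra_simps)
    moreover have "dist_nearest_int (L z) \<le> 1 - frac (L z)"
      using dist_nearest_int_le[of "L z" "\<lfloor>L z\<rfloor> + 1"] frac_lt_1[of "L z"]
      by (simp add: frac_def)
    ultimately have "dist_nearest_int (L z) * (real b)\<^sup>2 \<le> 1"
      using mult_right_mono[of "dist_nearest_int (L z)" "1 - frac (L z)" "(real b)\<^sup>2"] by simp
    then show thesis using z(1) \<open>z \<noteq> (0, 0)\<close>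
      by (intro that[of "int i" "int j"]) (auto simp: ij S_def L_def)
  next
    case False
    then obtain z w where zw: "z \<in> S" "w \<in> S" "z \<noteq> w" "f z = f w"
      by (auto simp: inj_on_def)
    obtain i j k l where ij: "z = (i, j)" and kl: "w = (k, l)" by (cases z, cases w)
    have "\<bar>(real b)\<^sup>2 * frac (L z) - (real b)\<^sup>2 * frac (L w)\<bar> \<le> 1"
      using f_bounds[of z] f_bounds[of w] zw(4) by linarith
    then have "\<bar>frac (L z) - frac (L w)\<bar> * (real b)\<^sup>2 \<le> 1"
      by (metis abs_mult abs_power2 mult.commute right_diff_distrib)
    moreover have "dist_nearest_int (L z - L w) \<le> \<bar>frac (L z) - frac (L w)\<bar>"
      using dist_nearest_int_le[of "L z - L w" "\<lfloor>L z\<rfloor> - \<lfloor>L w\<rfloor>"]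
      by (simp add: frac_def algebra_simps)
    ultimately have *: "dist_nearest_int (L z - L w) * (real b)\<^sup>2 \<le> 1"
      using mult_right_mono[of "dist_nearest_int (L z - L w)" "\<bar>frac (L z) - frac (L w)\<bar>" "(real b)\<^sup>2"]
      by simp
    have "L z - L w = of_int (int i - int k) * \<alpha> + of_int (int j - int l) * \<beta>"
      by (simp add: L_def ij kl algebra_simps)
    with * zw(1,2,3) show thesis
      by (intro that[of "int i - int k" "int j - int l"]) (auto simp: ij kl S_def)
  qed
qed

section \<open>Extremal properties of the sequence of best approximations\<close>

lemma best_approximation_height_pos:
  assumes "best_approximation \<alpha> \<beta> n"
  shows "0 < height n"
proof (rule ccontr)
  assume "\<not> 0 < height n"
  then have "n $ 2 = 0" "n $ 3 = 0" by (auto simp: height_def)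
  with assms show False
    by (auto simp: best_approximation_def linear_form_def dist_nearest_int_def vec_eq_iff forall_3)
qed

text \<open>Minimise over the finite box of nonzero pairs of height at most \<open>H\<close>. The
  minimiser is also minimal over the smaller box cut out by its own height, hence a best
  approximation once completed by \<open>- round \<xi>\<close>.\<close>

lemma best_approximation_below:
  fixes n\<^sub>1 n\<^sub>2 :: int
  assumes "0 < max \<bar>n\<^sub>1\<bar> \<bar>n\<^sub>2\<bar>"
  obtains y where "best_approximation \<alpha> \<beta> y" "0 < height y" "height y \<le> max \<bar>n\<^sub>1\<bar> \<bar>n\<^sub>2\<bar>"
    "\<bar>linear_form \<alpha> \<beta> y\<bar> \<le> dist_nearest_int (of_int n\<^sub>1 * \<alpha> + of_int n\<^sub>2 * \<beta>)"
proof -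
  define H where "H = max \<bar>n\<^sub>1\<bar> \<bar>n\<^sub>2\<bar>"
  define S where "S = {z :: int \<times> int. 0 < max \<bar>fst z\<bar> \<bar>snd z\<bar> \<and> max \<bar>fst z\<bar> \<bar>snd z\<bar> \<le> H}"
  define f where "f = (\<lambda>z :: int \<times> int. dist_nearest_int (of_int (fst z) * \<alpha> + of_int (snd z) * \<beta>))"
  have "S \<subseteq> {-H..H} \<times> {-H..H}" by (auto simp: S_def)
  then have fin: "finite S" using finite_subset by blast
  moreover have nS: "(n\<^sub>1, n\<^sub>2) \<in> S" using assms by (simp add: S_def H_def)
  ultimately have "Min (f ` S) \<in> f ` S" by (intro Min_in) auto
  then obtain z where z: "z \<in> S" "f z = Min (f ` S)" by auto
  have min: "f z \<le> f w" if "w \<in> S" for w using z fin that by simp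
  define \<xi> where "\<xi> = of_int (fst z) * \<alpha> + of_int (snd z) * \<beta>"
  define y :: "int ^ 3" where "y = vector [- round \<xi>, fst z, snd z]"
  have y: "y $ 2 = fst z" "y $ 3 = snd z" by (simp_all add: y_def)
  have form: "\<bar>linear_form \<alpha> \<beta> y\<bar> = dist_nearest_int \<xi>"
    by (simp add: y_def linear_form_def dist_nearest_int_def \<xi>_def)
  show thesis
  proof (rule that[of y])
    show "0 < height y" "height y \<le> max \<bar>n\<^sub>1\<bar> \<bar>n\<^sub>2\<bar>"
      using z(1) by (auto simp: height_def y S_def H_def)
    then have "y \<noteq> 0" by (auto simp: height_def)
    have "dist_nearest_int \<xi> \<le> dist_nearest_int (of_int k\<^sub>1 * \<alpha> + of_int k\<^sub>2 * \<beta>)"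
      if "0 < max \<bar>k\<^sub>1\<bar> \<bar>k\<^sub>2\<bar> \<and> max \<bar>k\<^sub>1\<bar> \<bar>k\<^sub>2\<bar> \<le> max \<bar>fst z\<bar> \<bar>snd z\<bar>" for k\<^sub>1 k\<^sub>2
    proof -
      have "(k\<^sub>1, k\<^sub>2) \<in> S" using that z(1) unfolding S_def mem_Collect_eq fst_conv snd_conv by linarith
      then show ?thesis using min[of "(k\<^sub>1, k\<^sub>2)"] by (simp add: f_def \<xi>_def)
    qed
    with \<open>y \<noteq> 0\<close> form show "best_approximation \<alpha> \<beta> y"
      unfolding best_approximation_def y \<xi>_def by blast
    show "\<bar>linear_form \<alpha> \<beta> y\<bar> \<le> dist_nearest_int (of_int n\<^sub>1 * \<alpha> + of_int n\<^sub>2 * \<beta>)"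
      using min[OF nS] form by (simp add: f_def \<xi>_def)
  qed
qed

lemma best_approximation_seq_height_less:
  assumes "best_approximation_seq \<alpha> \<beta> m" "1 \<le> \<mu>" "\<mu> < \<kappa>"
  shows "height (m \<mu>) < height (m \<kappa>)"
  using assms(3,2)
proof (induction rule: less_Suc_induct)
  case (1 i)
  then show ?case using assms(1) by (auto simp: best_approximation_seq_def)
next
  case (2 i j k)
  then show ?case by (meson less_imp_le order.strict_trans order.trans)
qed

lemma height_uminus: "height (- x) = height x"
  by (simp add: height_def)

text \<open>Some best approximation \<open>y\<close> does at least as well as the given pair at no
  larger height. The sequence lists \<open>y\<close> up to sign, and increasing heights put its
  index at or before \<mu>, so \<open>m \<mu>\<close> does at least as well as
  \<open>y\<close>.\<close>

lemma best_approximation_seq_minimal: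
  assumes seq: "best_approximation_seq \<alpha> \<beta> m" and \<mu>: "1 \<le> \<mu>"
    and n: "0 < max \<bar>n\<^sub>1\<bar> \<bar>n\<^sub>2\<bar>" "max \<bar>n\<^sub>1\<bar> \<bar>n\<^sub>2\<bar> < height (m (Suc \<mu>))"
  shows "\<bar>linear_form \<alpha> \<beta> (m \<mu>)\<bar> \<le> dist_nearest_int (of_int n\<^sub>1 * \<alpha> + of_int n\<^sub>2 * \<beta>)"
proof -
  obtain y where y: "best_approximation \<alpha> \<beta> y" "0 < height y" "height y \<le> max \<bar>n\<^sub>1\<bar> \<bar>n\<^sub>2\<bar>"
    "\<bar>linear_form \<alpha> \<beta> y\<bar> \<le> dist_nearest_int (of_int n\<^sub>1 * \<alpha> + of_int n\<^sub>2 * \<beta>)"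
    using best_approximation_below[OF n(1)] by blast
  then obtain \<kappa> where \<kappa>: "1 \<le> \<kappa>" "y = m \<kappa> \<or> y = - m \<kappa>"
    using seq unfolding best_approximation_seq_def by blast
  then have "height (m \<kappa>) = height y" by (auto simp: height_uminus)
  with y n have "height (m \<kappa>) < height (m (Suc \<mu>))" by linarith
  then have "\<not> Suc \<mu> < \<kappa>" "\<kappa> \<noteq> Suc \<mu>"
    using best_approximation_seq_height_less[OF seq, of "Suc \<mu>" \<kappa>] by auto
  then have "\<kappa> \<le> \<mu>" by simp
  then have "height (m \<kappa>) \<le> height (m \<mu>)"
    using best_approximation_seq_height_less[OF seq \<kappa>(1), of \<mu>] by (cases "\<kappa> = \<mu>") auto
  with \<open>height (m \<kappa>) = height y\<close> y(2)
  have h: "0 < max \<bar>y $ 2\<bar> \<bar>y $ 3\<bar> \<and> max \<bar>y $ 2\<bar> \<bar>y $ 3\<bar> \<le> max \<bar>m \<mu> $ 2\<bar> \<bar>m \<mu> $ 3\<bar>"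
    by (simp add: height_def)
  have "best_approximation \<alpha> \<beta> (m \<mu>)" using seq \<mu> by (simp add: best_approximation_seq_def)
  with h have "\<bar>linear_form \<alpha> \<beta> (m \<mu>)\<bar> \<le> dist_nearest_int (of_int (y $ 2) * \<alpha> + of_int (y $ 3) * \<beta>)"
    unfolding best_approximation_def by metis
  also have "\<dots> = \<bar>linear_form \<alpha> \<beta> y\<bar>" using y(1) by (simp add: best_approximation_def)
  finally show ?thesis using y(4) by simp
qed

lemma best_approximation_seq_dirichlet:
  assumes seq: "best_approximation_seq \<alpha> \<beta> m" and \<mu>: "1 \<le> \<mu>" and h: "2 \<le> height (m (Suc \<mu>))"
  shows "\<bar>linear_form \<alpha> \<beta> (m \<mu>)\<bar> * (real_of_int (height (m (Suc \<mu>))))\<^sup>2 \<le> 1"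
proof -
  define b where "b = nat (height (m (Suc \<mu>)))"
  have b: "2 \<le> b" "int b = height (m (Suc \<mu>))" using h by (auto simp: b_def)
  obtain n\<^sub>1 n\<^sub>2 where n: "0 < max \<bar>n\<^sub>1\<bar> \<bar>n\<^sub>2\<bar>" "max \<bar>n\<^sub>1\<bar> \<bar>n\<^sub>2\<bar> < int b"
    "dist_nearest_int (of_int n\<^sub>1 * \<alpha> + of_int n\<^sub>2 * \<beta>) * (real b)\<^sup>2 \<le> 1"
    using dirichlet_linear_form[OF b(1)] by blast
  have "\<bar>linear_form \<alpha> \<beta> (m \<mu>)\<bar> \<le> dist_nearest_int (of_int n\<^sub>1 * \<alpha> + of_int n\<^sub>2 * \<beta>)"
    using best_approximation_seq_minimal[OF seq \<mu>] n b by simp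
  then have "\<bar>linear_form \<alpha> \<beta> (m \<mu>)\<bar> * (real b)\<^sup>2 \<le> 1"
    using mult_right_mono[of _ _ "(real b)\<^sup>2"] n(3) by (meson order_trans zero_le_power2)
  then show ?thesis by (simp flip: b(2))
qed

lemma linear_form_zero_imp_zero:
  assumes "lin_indep_Z3 1 \<alpha> \<beta>" "linear_form \<alpha> \<beta> x = 0"
  shows "x = 0"
proof -
  have "x $ 1 = 0 \<and> x $ 2 = 0 \<and> x $ 3 = 0"
    using assms unfolding lin_indep_Z3_def linear_form_def by simp
  then show ?thesis by (simp add: vec_eq_iff forall_3)
qed

lemma best_approximation_seq_decreasing:
  assumes indep: "lin_indep_Z3 1 \<alpha> \<beta>" and seq: "best_approximation_seq \<alpha> \<beta> m"
    and \<mu>: "1 \<le> \<mu>" and h: "0 < height (m \<mu>)"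
  shows "\<bar>linear_form \<alpha> \<beta> (m (Suc \<mu>))\<bar> < \<bar>linear_form \<alpha> \<beta> (m \<mu>)\<bar>"
proof -
  have lt: "height (m \<mu>) < height (m (Suc \<mu>))"
    and best: "best_approximation \<alpha> \<beta> (m (Suc \<mu>))"
    using seq \<mu> by (simp_all add: best_approximation_seq_def)
  have "\<bar>linear_form \<alpha> \<beta> (m (Suc \<mu>))\<bar>
      \<le> dist_nearest_int (of_int (m \<mu> $ 2) * \<alpha> + of_int (m \<mu> $ 3) * \<beta>)"
    using best h lt unfolding best_approximation_def height_def by (metis less_imp_le)
  also have "\<dots> \<le> \<bar>linear_form \<alpha> \<beta> (m \<mu>)\<bar>" by (rule dist_nearest_int_le_linear_form)
  finally have le: "\<bar>linear_form \<alpha> \<beta> (m (Suc \<mu>))\<bar> \<le> \<bar>linear_form \<alpha> \<beta> (m \<mu>)\<bar>" .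
  moreover have "\<bar>linear_form \<alpha> \<beta> (m (Suc \<mu>))\<bar> \<noteq> \<bar>linear_form \<alpha> \<beta> (m \<mu>)\<bar>"
  proof
    assume "\<bar>linear_form \<alpha> \<beta> (m (Suc \<mu>))\<bar> = \<bar>linear_form \<alpha> \<beta> (m \<mu>)\<bar>"
    \<comment> \<open>By linear independence, a tie would make the two points equal up to sign,
      against the increase of heights.\<close>
    then have "linear_form \<alpha> \<beta> (m (Suc \<mu>) + m \<mu>) = 0 \<or> linear_form \<alpha> \<beta> (m (Suc \<mu>) + - m \<mu>) = 0"
      unfolding linear_form_add linear_form_minus by linarith
    then have "m (Suc \<mu>) = - m \<mu> \<or> m (Suc \<mu>) = m \<mu>"
      using linear_form_zero_imp_zero[OF indep]
      by (metis add.right_inverse add_eq_0_iff diff_add_cancel eq_neg_iff_add_eq_0 minus_minus)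
    with lt show False by (auto simp: height_uminus)
  qed
  ultimately show ?thesis by simp
qed

subsection \<open>Positive points from three independent best approximations\<close>

text \<open>Modulo \<open>P\<close> the two vectors have rank at most one, so they satisfy a
  nontrivial relation; its coefficients are then replaced by their residues of least absolute
  value.\<close>

lemma integral_relation_mod_prime:
  fixes x y :: "int ^ 3"
  assumes P: "prime P" and P3: "P dvd x $ 1 * y $ 2 - x $ 2 * y $ 1"
    and P2: "P dvd x $ 1 * y $ 3 - x $ 3 * y $ 1"
    and P1: "P dvd x $ 2 * y $ 3 - x $ 3 * y $ 2"
  obtains i j :: int where "2 * \<bar>i\<bar> \<le> P" "2 * \<bar>j\<bar> \<le> P" "i \<noteq> 0 \<or> j \<noteq> 0"
    "\<And>k. P dvd i * x $ k + j * y $ k"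
proof -
  have P0: "1 < P" using P prime_gt_1_int by blast
  have minor: "P dvd x $ k * y $ l - x $ l * y $ k" for k l
  proof -
    have "\<forall>k l. P dvd x $ k * y $ l - x $ l * y $ k"
      using P1 P2 P3 by (simp add: forall_3) (metis dvd_minus_iff minus_diff_eq)
    then show ?thesis by blast
  qed
  have "\<exists>i j. \<not> (P dvd i \<and> P dvd j) \<and> (\<forall>k. P dvd i * x $ k + j * y $ k)"
  proof (cases "\<forall>k. P dvd x $ k")
    case True
    then show ?thesis using P0 by (intro exI[of _ 1] exI[of _ 0]) auto
  next
    case False
    then obtain l where "\<not> P dvd x $ l" by blast
    moreover have "P dvd - (y $ l) * x $ k + x $ l * y $ k" for k
      using minor[of l k] by (simp add: algebra_simps)
    ultimately show ?thesis by blast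
  qed
  then obtain i j where ij: "\<not> (P dvd i \<and> P dvd j)" "\<And>k. P dvd i * x $ k + j * y $ k" by blast
  have "\<exists>e. 2 * \<bar>e\<bar> \<le> P \<and> P dvd i - e" for i
  proof -
    define e where "e = (if 2 * (i mod P) \<le> P then i mod P else i mod P - P)"
    have m: "0 \<le> i mod P" "i mod P < P" using P0 by auto
    have "P dvd i - i mod P" by (simp add: minus_mod_eq_mult_div)
    moreover have "P dvd i - i mod P + P" using calculation by simp
    ultimately have "P dvd i - e" by (simp add: e_def algebra_simps)
    moreover have "2 * \<bar>e\<bar> \<le> P" using m by (auto simp: e_def)
    ultimately show ?thesis by blast
  qed
  then obtain e f where e: "2 * \<bar>e\<bar> \<le> P" "P dvd i - e" and f: "2 * \<bar>f\<bar> \<le> P" "P dvd j - f"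
    by meson
  have "P dvd e * x $ k + f * y $ k" for k
  proof -
    have "e * x $ k + f * y $ k = (i * x $ k + j * y $ k) - ((i - e) * x $ k + (j - f) * y $ k)"
      by (simp add: algebra_simps)
    then show ?thesis using ij(2)[of k] e(2) f(2) by (metis dvd_add dvd_diff dvd_mult2)
  qed
  moreover have "e \<noteq> 0 \<or> f \<noteq> 0" using ij(1) e(2) f(2) by auto
  ultimately show thesis using that e(1) f(1) by blast
qed

text \<open>Collects what the construction uses of three consecutive best approximations.
  \<open>form_p\<close> and \<open>form_q\<close> are Dirichlet bounds; linear independence of 1,
  \<alpha>, \<beta> enters through the strictness of \<open>form_qr\<close>.\<close>

locale independent_triple =
  fixes \<alpha> \<beta> :: real and p q r :: "int ^ 3"
  assumes height_pq: "height p < height q" and height_qr: "height q < height r"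
    and form_p: "\<bar>linear_form \<alpha> \<beta> p\<bar> * (real_of_int (height q))\<^sup>2 \<le> 1"
    and form_q: "\<bar>linear_form \<alpha> \<beta> q\<bar> * (real_of_int (height r))\<^sup>2 \<le> 1"
    and form_qr: "\<bar>linear_form \<alpha> \<beta> r\<bar> < \<bar>linear_form \<alpha> \<beta> q\<bar>"
    and minimal: "\<And>x. 0 < height x \<Longrightarrow> height x < height r \<Longrightarrow> \<bar>linear_form \<alpha> \<beta> q\<bar> \<le> \<bar>linear_form \<alpha> \<beta> x\<bar>"
    and det_nonzero: "det (vector [p, q, r] :: int ^ 3 ^ 3) \<noteq> 0"
begin

abbreviation \<zeta> :: "int ^ 3 \<Rightarrow> real" where "\<zeta> \<equiv> linear_form \<alpha> \<beta>"
abbreviation a :: real where "a \<equiv> of_int (height q)"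
abbreviation b :: real where "b \<equiv> of_int (height r)"
abbreviation D :: real where
  "D \<equiv> of_int (q $ 2) * of_int (r $ 3) - of_int (q $ 3) * of_int (r $ 2)"

lemma a_ge: "1 \<le> a" and a_less_b: "a < b" and height_p: "height p \<le> a - 1"
  using height_pq height_qr height_nonneg[of p] by linarith+

lemma form_q_pos: "0 < \<bar>\<zeta> q\<bar>"
  using form_qr by linarith

text \<open>In the coordinates (\<zeta>, x2, x3), the point (0, w, w) is rounded to the lattice of
  \<open>p\<close>, \<open>q\<close>, \<open>r\<close>. The form error is of order
  \<open>1 / a^2\<close> by Dirichlet, while the size is of order \<open>b\<close>, which is good
  enough when \<open>b / a\<close> is bounded.\<close>

lemma positive_point_short_gap:
  obtains x where "0 < x $ 2" "0 < x $ 3" "of_int (max (x $ 2) (x $ 3)) \<le> 2 * a + b"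
    "\<bar>\<zeta> x\<bar> * a\<^sup>2 \<le> 3/2"
proof -
  \<comment> \<open>As \<open>p\<close> has height at most \<open>a - 1\<close>, the error in x2 and
    x3 is at most (a - 1 + a + b)/2 = w - 1/2, which preserves positivity.\<close>
  define w where "w = a + b / 2"
  have "of_int (det (vector [p, q, r] :: int ^ 3 ^ 3)) \<noteq> (0::real)" using det_nonzero by simp
  then have nz: "\<zeta> p * (of_int (q $ 2) * of_int (r $ 3) - of_int (q $ 3) * of_int (r $ 2)) -
    of_int (p $ 2) * (\<zeta> q * of_int (r $ 3) - of_int (q $ 3) * \<zeta> r) +
    of_int (p $ 3) * (\<zeta> q * of_int (r $ 2) - of_int (q $ 2) * \<zeta> r) \<noteq> 0"
    by (subst (asm) det_eq_linear_form[where \<alpha> = \<alpha> and \<beta> = \<beta>])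
  obtain i j k :: int and \<delta> \<epsilon> \<theta> :: real where e: "\<bar>\<delta>\<bar> \<le> 1/2" "\<bar>\<epsilon>\<bar> \<le> 1/2" "\<bar>\<theta>\<bar> \<le> 1/2"
    and ijk: "i * \<zeta> p + j * \<zeta> q + k * \<zeta> r = 0 + \<delta> * \<zeta> p + \<epsilon> * \<zeta> q + \<theta> * \<zeta> r"
    "real_of_int i * of_int (p $ 2) + real_of_int j * of_int (q $ 2) + real_of_int k * of_int (r $ 2) =
      w + \<delta> * of_int (p $ 2) + \<epsilon> * of_int (q $ 2) + \<theta> * of_int (r $ 2)"
    "real_of_int i * of_int (p $ 3) + real_of_int j * of_int (q $ 3) + real_of_int k * of_int (r $ 3) =
      w + \<delta> * of_int (p $ 3) + \<epsilon> * of_int (q $ 3) + \<theta> * of_int (r $ 3)"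
    by (rule lattice_cover_3[OF nz])
  define x where "x = i *s p + j *s q + k *s r"
  have p: "\<bar>real_of_int (p $ 2)\<bar> \<le> a - 1" "\<bar>real_of_int (p $ 3)\<bar> \<le> a - 1"
    using abs_component_le_height[of p] height_p by linarith+
  have "of_int (x $ 2) = w + \<delta> * of_int (p $ 2) + \<epsilon> * of_int (q $ 2) + \<theta> * of_int (r $ 2)"
    using ijk(2) by (simp add: x_def)
  then have "\<bar>of_int (x $ 2) - w\<bar> \<le> w - 1/2"
    using abs_mult_half[OF e(1) p(1)] abs_component_le_height(1)[of q, THEN abs_mult_half[OF e(2)]]
      abs_component_le_height(1)[of r, THEN abs_mult_half[OF e(3)]]
    unfolding w_def abs_le_iff by argo
  moreover have "of_int (x $ 3) = w + \<delta> * of_int (p $ 3) + \<epsilon> * of_int (q $ 3) + \<theta> * of_int (r $ 3)"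
    using ijk(3) by (simp add: x_def)
  then have "\<bar>of_int (x $ 3) - w\<bar> \<le> w - 1/2"
    using abs_mult_half[OF e(1) p(2)] abs_component_le_height(2)[of q, THEN abs_mult_half[OF e(2)]]
      abs_component_le_height(2)[of r, THEN abs_mult_half[OF e(3)]]
    unfolding w_def abs_le_iff by argo
  ultimately have x: "0 < real_of_int (x $ 2)" "0 < real_of_int (x $ 3)"
    "of_int (x $ 2) \<le> 2 * w" "of_int (x $ 3) \<le> 2 * w" by linarith+
  have "\<zeta> x = \<delta> * \<zeta> p + \<epsilon> * \<zeta> q + \<theta> * \<zeta> r"
    using ijk(1) by (simp add: x_def linear_form_add linear_form_scale)
  moreover have "\<bar>\<delta> * \<zeta> p\<bar> \<le> \<bar>\<zeta> p\<bar> / 2" "\<bar>\<epsilon> * \<zeta> q\<bar> \<le> \<bar>\<zeta> q\<bar> / 2" "\<bar>\<theta> * \<zeta> r\<bar> \<le> \<bar>\<zeta> q\<bar> / 2"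
    using form_qr by (simp_all add: abs_mult_half e(1,2,3) del: le_divide_eq_numeral1)
  ultimately have "\<bar>\<zeta> x\<bar> \<le> \<bar>\<zeta> p\<bar> / 2 + \<bar>\<zeta> q\<bar>" by linarith
  then have "\<bar>\<zeta> x\<bar> * a\<^sup>2 \<le> (\<bar>\<zeta> p\<bar> / 2 + \<bar>\<zeta> q\<bar>) * a\<^sup>2" by (intro mult_right_mono) auto
  also have "\<dots> = (\<bar>\<zeta> p\<bar> * a\<^sup>2) / 2 + \<bar>\<zeta> q\<bar> * a\<^sup>2" by (simp add: algebra_simps)
  also have "\<bar>\<zeta> q\<bar> * a\<^sup>2 \<le> \<bar>\<zeta> q\<bar> * b\<^sup>2"
    using a_ge a_less_b by (intro mult_left_mono power_mono) auto
  finally have "\<bar>\<zeta> x\<bar> * a\<^sup>2 \<le> 3/2" using form_p form_q by linarith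
  with x show thesis by (intro that[of x]) (auto simp: w_def)
qed

section \<open>Long gap between the heights of \<open>q\<close> and \<open>r\<close>\<close>

lemma D_lower_bound:
  assumes gap: "10 * a \<le> b"
  shows "3/5 * a\<^sup>2 \<le> \<bar>D\<bar>"
proof -
  define zp zq zr where "zp = \<bar>\<zeta> p\<bar>" and "zq = \<bar>\<zeta> q\<bar>" and "zr = \<bar>\<zeta> r\<bar>"
  have nn: "0 \<le> zp" "0 \<le> zq" "zr \<le> zq" "0 \<le> zr" using form_qr by (auto simp: zp_def zq_def zr_def)
  have "1 \<le> \<bar>det (vector [p, q, r] :: int ^ 3 ^ 3)\<bar>" using det_nonzero by linarith
  then have "1 \<le> \<bar>real_of_int (det (vector [p, q, r] :: int ^ 3 ^ 3))\<bar>" by linarith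
  also have "real_of_int (det (vector [p, q, r] :: int ^ 3 ^ 3)) = \<zeta> p * D -
    of_int (p $ 2) * (\<zeta> q * of_int (r $ 3) - of_int (q $ 3) * \<zeta> r) +
    of_int (p $ 3) * (\<zeta> q * of_int (r $ 2) - of_int (q $ 2) * \<zeta> r)"
    by (rule det_eq_linear_form)
  also have "\<bar>\<dots>\<bar> \<le> \<bar>\<zeta> p * D\<bar> +
    \<bar>of_int (p $ 2) * (\<zeta> q * of_int (r $ 3) - of_int (q $ 3) * \<zeta> r)\<bar> +
    \<bar>of_int (p $ 3) * (\<zeta> q * of_int (r $ 2) - of_int (q $ 2) * \<zeta> r)\<bar>" by linarith
  also have "\<dots> \<le> zp * \<bar>D\<bar> + a * (zq * (2 * b)) + a * (zq * (2 * b))"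
  proof -
    have "\<bar>\<zeta> q * of_int (r $ c) - of_int (q $ c) * \<zeta> r\<bar> \<le> zq * (2 * b)" if "c = 2 \<or> c = 3" for c
    proof -
      have "\<bar>\<zeta> q * of_int (r $ c) - of_int (q $ c) * \<zeta> r\<bar> \<le> zq * \<bar>of_int (r $ c)\<bar> + \<bar>of_int (q $ c)\<bar> * zr"
        unfolding zq_def zr_def abs_mult [symmetric] by linarith
      also have "\<dots> \<le> zq * b + b * zq"
        using that nn abs_component_le_height[of q] abs_component_le_height[of r] a_less_b a_ge
        by (intro add_mono mult_mono) auto
      finally show ?thesis by simp
    qed
    moreover have "\<bar>of_int (p $ 2)\<bar> \<le> a" "\<bar>of_int (p $ 3)\<bar> \<le> a"
      using abs_component_le_height[of p] height_p by linarith+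
    ultimately show ?thesis using nn a_ge
      unfolding abs_mult zp_def[symmetric] by (intro add_mono mult_mono) auto
  qed
  finally have 1: "1 \<le> zp * \<bar>D\<bar> + 4 * (a * b * zq)" by (simp add: algebra_simps)
  \<comment> \<open>The gap and the Dirichlet bound for \<open>q\<close> make the terms without
    \<open>\<zeta> p\<close> at most 2/5. The nonzero integer determinant leaves 3/5 for
    \<open>zp * |D|\<close>, and \<open>zp * a^2\<close> is at most 1.\<close>
  have "10 * (a * b * zq) \<le> b * b * zq" 
    using mult_right_mono[OF gap, of "b * zq"] nn a_ge a_less_b by (simp add: mult.assoc)
  also have "\<dots> \<le> 1" using form_q by (simp add: zq_def power2_eq_square mult_ac)
  finally have "3/5 \<le> zp * \<bar>D\<bar>" using 1 by linarith
  then have "3/5 * a\<^sup>2 \<le> (zp * a\<^sup>2) * \<bar>D\<bar>"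
    using mult_right_mono[of "3/5" "zp * \<bar>D\<bar>" "a\<^sup>2"] by (simp add: mult_ac)
  also have "\<dots> \<le> 1 * \<bar>D\<bar>"
    using form_p by (intro mult_right_mono) (auto simp: zp_def)
  finally show ?thesis by simp
qed

lemma D_nonzero: "D \<noteq> 0" if "10 * a \<le> b"
proof
  assume "D = 0"
  then have "3/5 * a\<^sup>2 \<le> 0" using D_lower_bound[OF that] by simp
  then show False using a_ge by (simp add: mult_le_0_iff)
qed

text \<open>Positivity is secured first, by rounding with a reduced basis of the plane of
  \<open>q\<close> and \<open>r\<close>; the form is then bounded through the coefficients
  \<open>i\<close> and \<open>j\<close>. Cramer's rule divides by \<open>D\<close>, so the lower
  bound for |D| keeps these in check.\<close>

lemma positive_point_long_gap_plane:
  assumes gap: "10 * a \<le> b"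
  obtains x where "0 < x $ 2" "0 < x $ 3" "of_int (max (x $ 2) (x $ 3)) \<le> 11/5 * b"
    "\<bar>\<zeta> x\<bar> * a\<^sup>2 \<le> 9 * (a * b * \<bar>\<zeta> q\<bar>)"
proof -
  have D: "3/5 * a\<^sup>2 \<le> \<bar>D\<bar>" using gap by (rule D_lower_bound)
  have a: "0 < a" using a_ge by simp
  have Dpos: "0 < \<bar>D\<bar>" using D_nonzero[OF gap] by simp
  have "max \<bar>real_of_int (q $ 2)\<bar> \<bar>of_int (q $ 3)\<bar> = a" by (simp add: height_def)
  then obtain i j :: int where ij:
    "0 < real_of_int i * of_int (q $ 2) + real_of_int j * real_of_int (r $ 2)" "0 < real_of_int i * of_int (q $ 3) + real_of_int j * real_of_int (r $ 3)"
    "real_of_int i * of_int (q $ 2) + real_of_int j * of_int (r $ 2) \<le> 7/4 * a + \<bar>D\<bar> / a"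
    "real_of_int i * of_int (q $ 3) + real_of_int j * of_int (r $ 3) \<le> 7/4 * a + \<bar>D\<bar> / a"
    using lattice_cover_reduced[of "of_int (q $ 2)" "of_int (r $ 3)" "of_int (q $ 3)" "of_int (r $ 2)" a] Dpos a
    by auto
  define x where "x = i *s q + j *s r"
  have x2: "real_of_int (x $ 2) = real_of_int i * of_int (q $ 2) + real_of_int j * of_int (r $ 2)"
    and x3: "real_of_int (x $ 3) = real_of_int i * of_int (q $ 3) + real_of_int j * of_int (r $ 3)"
    by (simp_all add: x_def)
  define X where "X = 7/4 * a + \<bar>D\<bar> / a"
  have xX: "\<bar>real_of_int (x $ 2)\<bar> \<le> X" "\<bar>real_of_int (x $ 3)\<bar> \<le> X"
    using ij unfolding x2 x3 X_def by auto
  have X0: "0 \<le> X" using xX(1) by linarith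
  have cross: "\<bar>u * v - w * z\<bar> \<le> 2 * (X * B)"
    if "\<bar>u\<bar> \<le> X" "\<bar>w\<bar> \<le> X" "\<bar>v\<bar> \<le> B" "\<bar>z\<bar> \<le> B" for u v w z B :: real
  proof -
    have "\<bar>u * v\<bar> \<le> X * B" "\<bar>w * z\<bar> \<le> X * B"
      unfolding abs_mult using that X0 by (auto intro!: mult_mono)
    then show ?thesis by linarith
  qed
  have iD: "of_int i * D = of_int (x $ 2) * of_int (r $ 3) - of_int (x $ 3) * of_int (r $ 2)"
    and jD: "of_int j * D = of_int (x $ 3) * of_int (q $ 2) - of_int (x $ 2) * of_int (q $ 3)"
    unfolding x2 x3 by (simp_all add: algebra_simps)
  have "\<bar>of_int i * D\<bar> \<le> 2 * (X * b)" "\<bar>of_int j * D\<bar> \<le> 2 * (X * a)"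
    unfolding iD jD by (intro cross xX abs_component_le_height)+
  then have ij_le: "\<bar>of_int i * D\<bar> * \<bar>\<zeta> q\<bar> \<le> 2 * (X * b) * \<bar>\<zeta> q\<bar>"
    "\<bar>of_int j * D\<bar> * \<bar>\<zeta> r\<bar> \<le> 2 * (X * a) * \<bar>\<zeta> q\<bar>"
    using form_qr X0 a by (intro mult_mono; simp)+
  have "\<zeta> x = of_int i * \<zeta> q + of_int j * \<zeta> r"
    by (simp add: x_def linear_form_add linear_form_scale)
  then have "\<bar>\<zeta> x\<bar> * \<bar>D\<bar> = \<bar>of_int i * D * \<zeta> q + of_int j * D * \<zeta> r\<bar>"
    by (simp add: algebra_simps flip: abs_mult)
  also have "\<dots> \<le> \<bar>of_int i * D\<bar> * \<bar>\<zeta> q\<bar> + \<bar>of_int j * D\<bar> * \<bar>\<zeta> r\<bar>"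
    unfolding abs_mult [symmetric] by (rule abs_triangle_ineq)
  also have "\<dots> \<le> 2 * (X * (a + b)) * \<bar>\<zeta> q\<bar>"
    using ij_le by (simp add: algebra_simps)
  also have "\<dots> \<le> 2 * (X * (11/10 * b)) * \<bar>\<zeta> q\<bar>"
    using gap X0 by (intro mult_right_mono mult_left_mono) auto
  finally have "\<bar>\<zeta> x\<bar> * \<bar>D\<bar> \<le> 11/5 * (X * (b * \<bar>\<zeta> q\<bar>))" by simp
  then have "\<bar>\<zeta> x\<bar> * \<bar>D\<bar> * a \<le> 11/5 * (X * (b * \<bar>\<zeta> q\<bar>)) * a"
    using a by (intro mult_right_mono) auto
  also have "\<dots> = 11/5 * (X * a) * (b * \<bar>\<zeta> q\<bar>)" by simp
  \<comment> \<open>From \<open>a^2 <= 5/3 * |D|\<close> the factor is 7/4 * 5/3 + 1 =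
    47/12.\<close>
  also have "X * a \<le> 4 * \<bar>D\<bar>"
  proof -
    have "X * a = 7/4 * a\<^sup>2 + \<bar>D\<bar>" using a by (simp add: X_def power2_eq_square distrib_right)
    moreover have "x \<le> 4 * d" if "x = 7/4 * u + d" "3/5 * u \<le> d" "0 \<le> u" for x d u :: real
      using that by linarith
    ultimately show ?thesis using D zero_le_power2[of a] by blast
  qed
  then have "11/5 * (X * a) * (b * \<bar>\<zeta> q\<bar>) \<le> 11/5 * (4 * \<bar>D\<bar>) * (b * \<bar>\<zeta> q\<bar>)"
    using a a_less_b by (intro mult_right_mono mult_left_mono) auto
  finally have "(\<bar>\<zeta> x\<bar> * a) * \<bar>D\<bar> \<le> (44/5 * (b * \<bar>\<zeta> q\<bar>)) * \<bar>D\<bar>"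
    by (simp add: mult_ac)
  then have "\<bar>\<zeta> x\<bar> * a \<le> 44/5 * (b * \<bar>\<zeta> q\<bar>)" using Dpos by simp
  then have "\<bar>\<zeta> x\<bar> * a * a \<le> 44/5 * (b * \<bar>\<zeta> q\<bar>) * a" using a by (intro mult_right_mono) auto
  also have "\<dots> \<le> 9 * (a * b * \<bar>\<zeta> q\<bar>)"
    using a a_less_b by (simp add: mult_ac)
  finally have form: "\<bar>\<zeta> x\<bar> * a\<^sup>2 \<le> 9 * (a * b * \<bar>\<zeta> q\<bar>)" by (simp add: power2_eq_square mult_ac)
  have "\<bar>of_int (q $ 2) * of_int (r $ 3)\<bar> \<le> a * b" "\<bar>of_int (q $ 3) * of_int (r $ 2)\<bar> \<le> a * b"
    unfolding abs_mult using abs_component_le_height[of q] abs_component_le_height[of r] a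
    by (auto intro!: mult_mono)
  then have "\<bar>D\<bar> \<le> 2 * b * a" by (simp add: mult.commute)
  then have "\<bar>D\<bar> / a \<le> 2 * b" using a by (simp add: divide_le_eq)
  then have "X \<le> 11/5 * b" using gap a unfolding X_def by linarith
  with xX form ij x2 x3 show thesis by (intro that[of x]) auto
qed

text \<open>
If a prime \<open>P\<close> divided all minors of \<open>q, r\<close>, then some \<open>(i q + j r) / P\<close> with \<open>\<bar>i\<bar>, \<bar>j\<bar> \<le> P / 2\<close> would be
integral and contradict the minimality of \<open>q\<close>.
\<close>

lemma unit_level_point:
  assumes D0: "D \<noteq> 0"
  obtains y where "det (vector [y, q, r] :: int ^ 3 ^ 3) = 1"
proof -
  define n1 where "n1 = q $ 2 * r $ 3 - q $ 3 * r $ 2"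
  define n2 where "n2 = q $ 1 * r $ 3 - q $ 3 * r $ 1"
  define n3 where "n3 = q $ 1 * r $ 2 - q $ 2 * r $ 1"
  define g where "g = gcd n1 (gcd n2 n3)"
  have n1: "of_int n1 = D" by (simp add: n1_def)
  then have "n1 \<noteq> 0" using D0 by auto
  have "is_unit g"
  proof (rule ccontr)
    assume "\<not> is_unit g"
    moreover have "g \<noteq> 0" using \<open>n1 \<noteq> 0\<close> by (simp add: g_def)
    ultimately obtain P where P: "prime P" "P dvd g" using prime_divisor_exists by blast
    then have "P dvd n1" "P dvd n2" "P dvd n3" by (auto simp: g_def)
    then obtain i j where ij: "2 * \<bar>i\<bar> \<le> P" "2 * \<bar>j\<bar> \<le> P" "i \<noteq> 0 \<or> j \<noteq> 0"
      and dvd: "\<And>k. P dvd i * q $ k + j * r $ k"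
      using integral_relation_mod_prime[of P q r] P(1) unfolding n1_def n2_def n3_def by blast
    have P1: "1 < P" using P prime_gt_1_int by blast
    define z :: "int ^ 3" where "z = (\<chi> k. (i * q $ k + j * r $ k) div P)"
    have "i *s q + j *s r = P *s z"
      using dvd by (simp add: z_def vec_eq_iff)
    then have Pz: "P * z $ k = i * q $ k + j * r $ k" for k
      by (metis vector_add_component vector_smult_component)
    have "of_int P * \<zeta> z = of_int i * \<zeta> q + of_int j * \<zeta> r"
      using \<open>i *s q + j *s r = P *s z\<close> by (metis linear_form_add linear_form_scale)
    have i: "\<bar>of_int i / of_int P\<bar> \<le> (1/2::real)" and j: "\<bar>of_int j / of_int P\<bar> \<le> (1/2::real)"
      using ij P1 by (simp_all add: divide_le_eq flip: of_int_abs)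
    have "\<zeta> z = (of_int i / of_int P) * \<zeta> q + (of_int j / of_int P) * \<zeta> r"
      using \<open>of_int P * \<zeta> z = _\<close> P1 by (simp add: field_simps)
    then have small: "\<bar>\<zeta> z\<bar> < \<bar>\<zeta> q\<bar>"
      using abs_mult_half[OF i, of "\<zeta> q" "\<bar>\<zeta> q\<bar>"] abs_mult_half[OF j, of "\<zeta> r" "\<bar>\<zeta> r\<bar>"] form_qr by linarith
    have "\<bar>real_of_int (z $ c)\<bar> < b" if "c = 2 \<or> c = 3" for c
    proof -
      have "of_int P * real_of_int (z $ c) = of_int i * of_int (q $ c) + of_int j * of_int (r $ c)"
        using Pz[of c] by (metis of_int_add of_int_mult)
      then have "real_of_int (z $ c) = (of_int i / of_int P) * of_int (q $ c) + (of_int j / of_int P) * of_int (r $ c)"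
        using P1 by (simp add: field_simps)
      moreover have "\<bar>(of_int i / of_int P) * real_of_int (q $ c)\<bar> \<le> a / 2"
        "\<bar>(of_int j / of_int P) * real_of_int (r $ c)\<bar> \<le> b / 2"
        using that abs_component_le_height[of q, THEN abs_mult_half[OF i]]
          abs_component_le_height[of r, THEN abs_mult_half[OF j]] by blast+
      ultimately show ?thesis using a_less_b unfolding abs_le_iff abs_less_iff by argo
    qed
    from this[of 2] this[of 3] have "height z < height r" by (simp add: height_def[of z] flip: of_int_abs)
    with minimal[of z] small have "height z = 0" using height_nonneg[of z] by fastforce
    then have z23: "z $ 2 = 0" "z $ 3 = 0" by (auto simp: height_def)
    \<comment> \<open>Cramer's rule for the minor \<open>n1\<close>: once \<open>z $ 2\<close> and
      \<open>z $ 3\<close> vanish, so do \<open>i\<close> and \<open>j\<close>.\<close>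
    have "i * n1 = (i * q $ 2 + j * r $ 2) * r $ 3 - (i * q $ 3 + j * r $ 3) * r $ 2"
      "j * n1 = (i * q $ 3 + j * r $ 3) * q $ 2 - (i * q $ 2 + j * r $ 2) * q $ 3"
      by (simp_all add: n1_def algebra_simps)
    then have "i * n1 = 0" "j * n1 = 0" using z23 by (simp_all flip: Pz)
    with \<open>n1 \<noteq> 0\<close> ij(3) show False by simp
  qed
  then have "g = 1" using zdvd1_eq by (simp add: g_def)
  \<comment> \<open>The cofactors of the free first row are \<open>n1\<close>, \<open>- n2\<close>,
    \<open>n3\<close>, so a Bezout relation for the coprime minors supplies that row.\<close>
  obtain u v where "u * n2 + v * n3 = gcd n2 n3" using bezout_int by blast
  moreover obtain s t where "s * n1 + t * gcd n2 n3 = g" unfolding g_def using bezout_int by blast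
  ultimately have "s * n1 + t * (u * n2 + v * n3) = 1" using \<open>g = 1\<close> by simp
  then have "det (vector [vector [s, - t * u, t * v], q, r] :: int ^ 3 ^ 3) = 1"
    by (simp add: det_3 n1_def n2_def n3_def algebra_simps)
  then show thesis by (rule that)
qed

text \<open>Rounding along \<open>q\<close> and \<open>r\<close> alone preserves the level of the
  determinant and costs at most |\<zeta> q| in the form. On level \<open>H\<close> the line \<zeta>
  = 0 reads \<open>\<sigma> * (x_l * c k - x_k * c l) = H\<close>, with \<open>c\<close> of order
  \<open>b * |\<zeta> q|\<close>; this explains the size bound.\<close>

lemma positive_point_long_gap_level:
  assumes gap: "10 * a \<le> b"
  obtains x where "0 < x $ 2" "0 < x $ 3" "of_int (max (x $ 2) (x $ 3)) * (b * \<bar>\<zeta> q\<bar>) \<le> 6"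
    "\<bar>\<zeta> x\<bar> \<le> \<bar>\<zeta> q\<bar>"
proof -
  have a: "0 < a" using a_ge by simp
  have b: "0 < b" using a a_less_b by simp
  have D0: "D \<noteq> 0" using gap by (rule D_nonzero)
  obtain y where y: "det (vector [y, q, r] :: int ^ 3 ^ 3) = 1" using unit_level_point[OF D0] by blast
  define zq where "zq = \<bar>\<zeta> q\<bar>"
  have zq: "0 < zq" "zq * b\<^sup>2 \<le> 1" using form_q form_q_pos by (auto simp: zq_def)
  define c where "c = (\<lambda>k. \<zeta> q * of_int (r $ k) - of_int (q $ k) * \<zeta> r)"
  have qa: "\<bar>of_int (q $ k) * \<zeta> r\<bar> \<le> 1/10 * (zq * b)" if "k = 2 \<or> k = 3" for k
  proof -
    have "\<bar>of_int (q $ k) * \<zeta> r\<bar> \<le> a * zq"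
      unfolding abs_mult using that abs_component_le_height[of q] form_qr a
      by (auto intro!: mult_mono simp: zq_def)
    also have "\<dots> \<le> (1/10 * b) * zq" using gap zq by (intro mult_right_mono) auto
    finally show ?thesis by (simp add: mult_ac)
  qed
  have c_upper: "\<bar>c k\<bar> \<le> 11/10 * (zq * b)" if "k = 2 \<or> k = 3" for k
  proof -
    have "\<bar>\<zeta> q * of_int (r $ k)\<bar> \<le> zq * b"
      unfolding abs_mult zq_def[symmetric] using that abs_component_le_height[of r] zq
      by (intro mult_left_mono) auto
    then show ?thesis using qa[OF that] unfolding c_def by linarith
  qed
  \<comment> \<open>In a coordinate where \<open>r\<close> attains its height, the term with
    \<open>\<zeta> q\<close> dominates \<open>c k\<close> and bounds it away from 0.\<close>
  have "\<exists>k l. (k = 2 \<and> l = 3 \<or> k = 3 \<and> l = 2) \<and> \<bar>of_int (r $ k)\<bar> = b"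
  proof -
    have "\<bar>real_of_int (r $ 2)\<bar> = b \<or> \<bar>real_of_int (r $ 3)\<bar> = b" by (auto simp: height_def)
    then show ?thesis by blast
  qed
  then obtain k l :: 3 where kl: "k = 2 \<and> l = 3 \<or> k = 3 \<and> l = 2" and rk: "\<bar>of_int (r $ k)\<bar> = b" by blast
  have "\<bar>\<zeta> q * of_int (r $ k)\<bar> = zq * b" by (simp add: abs_mult rk zq_def)
  then have c_lower: "9/10 * (zq * b) \<le> \<bar>c k\<bar>" using qa[of k] kl unfolding c_def by linarith
  have zb: "zq * b * b \<le> 1" using zq by (simp add: power2_eq_square mult_ac)
  define \<sigma> :: real where "\<sigma> = (if k = 2 then 1 else - 1)"
  have level: "of_int (det (vector [x, q, r] :: int ^ 3 ^ 3)) =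
      \<zeta> x * D + \<sigma> * (of_int (x $ l) * c k - of_int (x $ k) * c l)" for x
    using kl unfolding det_eq_linear_form[where \<alpha> = \<alpha> and \<beta> = \<beta>] c_def \<sigma>_def by auto
  \<comment> \<open>Level \<open>\<plusminus>3\<close> rather than \<open>\<plusminus>1\<close> makes \<open>wl \<ge> b\<close>, so the rounding error cannot destroy positivity.\<close>
  define H :: int where "H = (if k = 2 then 3 else - 3) * (if 0 \<le> c k then 1 else - 1)"
  \<comment> \<open>The \<open>l\<close>-th coordinate on that line when the \<open>k\<close>-th is
    \<open>b\<close>; the sign of \<open>H\<close> makes the leading term
    \<open>3 / |c k|\<close>.\<close>
  define wl where "wl = (\<sigma> * H + b * c l) / c k"
  define w where "w = (\<lambda>e. if e = k then b else wl)"
  have "0 < zq * b" using zq(1) b by simp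
  then have ck: "c k \<noteq> 0" using c_lower by auto
  have w: "w k = b" "w l = wl" using kl by (auto simp: w_def)
  have bcl: "\<bar>b * c l\<bar> \<le> 11/10"
  proof -
    have "\<bar>b * c l\<bar> \<le> b * (11/10 * (zq * b))"
      unfolding abs_mult using c_upper[of l] kl b by (intro mult_mono) auto
    also have "\<dots> = 11/10 * (zq * b * b)" by simp
    finally show ?thesis using zb by linarith
  qed
  have wl: "wl * \<bar>c k\<bar> = 3 + (if 0 \<le> c k then 1 else - 1) * (b * c l)"
    using ck by (auto simp: wl_def H_def \<sigma>_def)
  have wl_bounds: "19/10 \<le> wl * \<bar>c k\<bar>" "wl * \<bar>c k\<bar> \<le> 41/10"
    unfolding wl using bcl by (auto simp: abs_le_iff)
  then have "0 < wl * \<bar>c k\<bar>" by linarith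
  then have wl0: "0 < wl" by (simp add: zero_less_mult_iff)
  have "b \<le> wl"
  proof -
    have "b * (zq * b) \<le> 1" using zb by (simp add: mult_ac)
    moreover have "19/10 \<le> wl * (11/10 * (zq * b))"
      using wl_bounds(1) mult_left_mono[OF c_upper less_imp_le[OF wl0], of k] kl by linarith
    ultimately have "b * (zq * b) \<le> wl * (zq * b)" by linarith
    then show ?thesis using b zq by simp
  qed
  have wl_zb: "wl * (zq * b) \<le> 5"
  proof -
    have "wl * (9/10 * (zq * b)) \<le> wl * \<bar>c k\<bar>" using c_lower wl0 by (intro mult_left_mono) auto
    then show ?thesis using wl_bounds(2) by linarith
  qed
  obtain i j :: int and \<delta> \<epsilon> :: real where e: "\<bar>\<delta>\<bar> \<le> 1/2" "\<bar>\<epsilon>\<bar> \<le> 1/2" and ij: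
    "of_int i * of_int (q $ 2) + of_int j * of_int (r $ 2) = (w 2 - of_int (H * y $ 2)) + \<delta> * of_int (q $ 2) + \<epsilon> * of_int (r $ 2)"
    "of_int i * of_int (q $ 3) + of_int j * of_int (r $ 3) = (w 3 - of_int (H * y $ 3)) + \<delta> * of_int (q $ 3) + \<epsilon> * of_int (r $ 3)"
    by (rule lattice_cover_2[OF D0])
  define x where "x = H *s y + i *s q + j *s r"
  have xw: "of_int (x $ e) = w e + \<delta> * of_int (q $ e) + \<epsilon> * of_int (r $ e)" if "e = k \<or> e = l" for e
    using that kl ij by (auto simp: x_def)
  \<comment> \<open>Both \<open>x\<close> and the target \<open>w\<close>, taken with form value 0,
    lie on level \<open>H\<close>. Comparing their level equations isolates
    \<open>\<zeta> x\<close>, since \<open>D\<close> is nonzero.\<close>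
  have "det (vector [x, q, r] :: int ^ 3 ^ 3) = H * det (vector [y, q, r] :: int ^ 3 ^ 3)"
    by (simp add: det_3 x_def algebra_simps)
  then have "of_int H = \<zeta> x * D + \<sigma> * (of_int (x $ l) * c k - of_int (x $ k) * c l)"
    using level[of x] y by simp
  also have "\<dots> = \<zeta> x * D + \<sigma> * (w l * c k - w k * c l)
      + \<delta> * (\<sigma> * (of_int (q $ l) * c k - of_int (q $ k) * c l))
      + \<epsilon> * (\<sigma> * (of_int (r $ l) * c k - of_int (r $ k) * c l))"
    by (simp add: xw algebra_simps)
  also have "\<sigma> * (of_int (q $ l) * c k - of_int (q $ k) * c l) = - (\<zeta> q * D)"
    using level[of q] by (simp add: det_3)
  also have "\<sigma> * (of_int (r $ l) * c k - of_int (r $ k) * c l) = - (\<zeta> r * D)"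
    using level[of r] by (simp add: det_3)
  also have "w l * c k - w k * c l = \<sigma> * H"
    unfolding w using ck by (simp add: wl_def)
  also have "\<sigma> * (\<sigma> * H) = H" by (simp add: \<sigma>_def)
  finally have "\<zeta> x * D = (\<delta> * \<zeta> q + \<epsilon> * \<zeta> r) * D" by (simp add: algebra_simps)
  then have "\<zeta> x = \<delta> * \<zeta> q + \<epsilon> * \<zeta> r" using D0 by simp
  moreover have "\<bar>\<delta> * \<zeta> q\<bar> \<le> \<bar>\<zeta> q\<bar> / 2" "\<bar>\<epsilon> * \<zeta> r\<bar> \<le> \<bar>\<zeta> q\<bar> / 2"
    using form_qr by (simp_all add: abs_mult_half e(1,2) del: le_divide_eq_numeral1)
  ultimately have form: "\<bar>\<zeta> x\<bar> \<le> \<bar>\<zeta> q\<bar>" by linarith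
  have dev: "\<bar>of_int (x $ e) - w e\<bar> \<le> (a + b) / 2" if "e = k \<or> e = l" for e
  proof -
    have "\<bar>\<delta> * of_int (q $ e)\<bar> \<le> a / 2" "\<bar>\<epsilon> * of_int (r $ e)\<bar> \<le> b / 2"
      using that kl abs_component_le_height[of q, THEN abs_mult_half[OF e(1)]]
        abs_component_le_height[of r, THEN abs_mult_half[OF e(2)]] by blast+
    then show ?thesis using xw[OF that] unfolding abs_le_iff by argo
  qed
  have w_bounds: "b \<le> w e" "w e \<le> wl" if "e = k \<or> e = l" for e
    using that w \<open>b \<le> wl\<close> by auto
  have x_pos: "0 < real_of_int (x $ e)" if "e = k \<or> e = l" for e
    using dev[OF that] w_bounds[OF that] a_less_b unfolding abs_le_iff by argo
  have x_le: "real_of_int (x $ e) * (zq * b) \<le> 6" if "e = k \<or> e = l" for e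
  proof -
    have "real_of_int (x $ e) \<le> wl + 11/20 * b"
      using dev[OF that] w_bounds[OF that] gap unfolding abs_le_iff by argo
    then have "real_of_int (x $ e) * (zq * b) \<le> (wl + 11/20 * b) * (zq * b)"
      using zq b by (intro mult_right_mono) auto
    also have "\<dots> = wl * (zq * b) + 11/20 * (zq * b * b)" by (simp add: algebra_simps)
    finally show ?thesis using wl_zb zb by linarith
  qed
  show thesis
  proof (rule that[OF _ _ _ form])
    show "0 < x $ 2" "0 < x $ 3" using x_pos[of 2] x_pos[of 3] kl by auto
    show "of_int (max (x $ 2) (x $ 3)) * (b * \<bar>\<zeta> q\<bar>) \<le> 6"
      using x_le[of 2] x_le[of 3] kl by (auto simp: zq_def mult.commute max_def)
  qed
qed

section \<open>Balancing the constructions at the golden ratio\<close>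

lemma positive_point_golden:
  fixes X :: "int ^ 3 \<Rightarrow> real"
  defines "X \<equiv> \<lambda>x. of_int (max (x $ 2) (x $ 3))"
  obtains x where "0 < x $ 2" "0 < x $ 3"
    "X x \<le> 240 * b powr golden_ratio * a powr (- 1 / golden_ratio)"
    "\<bar>\<zeta> x\<bar> \<le> 24 powr golden_ratio * a powr ((1 - golden_ratio) / golden_ratio) * X x powr (- golden_ratio)"
proof -
  let ?\<tau> = golden_ratio
  define t where "t = b / a"
  define s where "s = a\<^sup>2 * \<bar>\<zeta> q\<bar>"
  have a: "0 < a" using a_ge by simp
  have b: "0 < b" using a a_less_b by simp
  have t: "1 < t" "0 < t" using a a_less_b by (auto simp: t_def)
  have s: "0 < s" using a form_q_pos by (auto simp: s_def)
  have ts: "t * s = a * b * \<bar>\<zeta> q\<bar>" using a by (simp add: t_def s_def power2_eq_square)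
  have t\<tau>: "1 \<le> t powr ?\<tau>" using t golden_ratio_gt by (intro ge_one_powr_ge_zero) auto
  note witness = that
  have ex: "thesis" if "0 < x $ 2" "0 < x $ 3" "0 < K" "0 \<le> E" "X x \<le> K * a" "\<bar>\<zeta> x\<bar> * a\<^sup>2 \<le> E"
    "E * K powr ?\<tau> \<le> 24 powr ?\<tau>" "K \<le> 240 * t powr ?\<tau>" for x K E
  proof -
    have "0 < X x" using that(1) by (simp add: X_def)
    from golden_bounds[OF a b this that(3-7)] that(8)
    show thesis by (intro witness[OF that(1,2)]) (simp_all add: t_def)
  qed
  have base: "10 powr 1 \<le> 10 powr ?\<tau>" "2 powr 1 \<le> 2 powr ?\<tau>"
    using golden_ratio_gt by (intro powr_mono; simp)+
  consider "b \<le> 10 * a" | "10 * a \<le> b" "s * t powr (1 + ?\<tau>) \<le> 1" | "10 * a \<le> b" "1 \<le> s * t powr (1 + ?\<tau>)"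
    by linarith
  then show thesis
  proof cases
    case 1
    obtain x where x: "0 < x $ 2" "0 < x $ 3" "X x \<le> 2 * a + b" "\<bar>\<zeta> x\<bar> * a\<^sup>2 \<le> 3/2"
      using positive_point_short_gap unfolding X_def by blast
    \<comment> \<open>Here \<open>K = 12\<close> because
      \<open>2 * a + b \<le> 12 * a\<close>.\<close>
    have "3/2 * 12 powr ?\<tau> \<le> 2 powr ?\<tau> * 12 powr ?\<tau>"
      using base by (intro mult_right_mono) auto
    also have "\<dots> = 24 powr ?\<tau>" by (simp flip: powr_mult)
    finally show thesis using x 1 t\<tau> by (intro ex[of x 12 "3/2"]) auto
  next
    case 2
    obtain x where x: "0 < x $ 2" "0 < x $ 3" "X x \<le> 11/5 * b" "\<bar>\<zeta> x\<bar> * a\<^sup>2 \<le> 9 * (t * s)"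
      using positive_point_long_gap_plane[OF 2(1)] unfolding X_def ts by blast
    have "(11/5 * t) powr ?\<tau> = (11/5) powr ?\<tau> * t powr ?\<tau>" by (rule powr_mult)
    then have "9 * (t * s) * (11/5 * t) powr ?\<tau> = 9 * (11/5) powr ?\<tau> * (s * t powr (1 + ?\<tau>))"
      using t by (simp add: powr_add)
    also have "\<dots> \<le> 9 * (11/5) powr ?\<tau> * 1" using 2(2) by (intro mult_left_mono) auto
    \<comment> \<open>The power of 10 absorbs the factor 9, and 10 * 11/5 = 22 stays below
      24.\<close>
    also have "\<dots> \<le> 10 powr ?\<tau> * (11/5) powr ?\<tau>" using base by simp
    also have "\<dots> = 22 powr ?\<tau>" by (simp flip: powr_mult)
    also have "\<dots> \<le> 24 powr ?\<tau>" using golden_ratio_gt by (intro powr_mono2) auto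
    finally have E: "9 * (t * s) * (11/5 * t) powr ?\<tau> \<le> 24 powr ?\<tau>" .
    have "t powr 1 \<le> t powr ?\<tau>" using t golden_ratio_gt by (intro powr_mono) auto
    then have "11/5 * t \<le> 240 * t powr ?\<tau>" using t by simp
    then show thesis using x E t s a by (intro ex[of x "11/5 * t" "9 * (t * s)"]) (auto simp: t_def)
  next
    case 3
    obtain x where x: "0 < x $ 2" "0 < x $ 3" "X x * (b * \<bar>\<zeta> q\<bar>) \<le> 6" "\<bar>\<zeta> x\<bar> \<le> \<bar>\<zeta> q\<bar>"
      using positive_point_long_gap_level[OF 3(1)] unfolding X_def by blast
    \<comment> \<open>\<open>v\<close> measures the excess over the threshold. As \<tau>^2 = \<tau>
      + 1, the powers of \<open>t\<close> in \<open>E * K powr \<tau>\<close> cancel, leaving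
      \<open>6 powr \<tau> * v powr (1 - \<tau>)\<close>, while
      \<open>K = 6 * t powr \<tau> / v\<close>.\<close>
    define v where "v = s * t powr (1 + ?\<tau>)"
    have v: "1 \<le> v" using 3 by (simp add: v_def)
    have s_eq: "s = v * t powr (- 1 - ?\<tau>)"
      using t by (simp add: v_def mult.assoc flip: powr_add)
    have "t * s = v * (t powr 1 * t powr (- 1 - ?\<tau>))" using t by (simp add: s_eq)
    also have "\<dots> = v * t powr (- ?\<tau>)" unfolding powr_add [symmetric] by simp
    finally have ts_eq: "t * s = v * t powr (- ?\<tau>)" .
    have "(6 / (t * s)) powr ?\<tau> = 6 powr ?\<tau> / (v powr ?\<tau> * (t powr (- ?\<tau>)) powr ?\<tau>)"
      unfolding ts_eq using v t by (simp add: powr_divide powr_mult)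
    also have "- ?\<tau> * ?\<tau> = - 1 - ?\<tau>" using golden_ratio_sq by simp
    then have "(t powr (- ?\<tau>)) powr ?\<tau> = t powr (- 1 - ?\<tau>)" by (simp only: powr_powr)
    finally have "s * (6 / (t * s)) powr ?\<tau> = 6 powr ?\<tau> * (v / v powr ?\<tau>)"
      using t by (simp add: s_eq)
    also have "v powr 1 \<le> v powr ?\<tau>" using v golden_ratio_gt by (intro powr_mono) auto
    then have "6 powr ?\<tau> * (v / v powr ?\<tau>) \<le> 6 powr ?\<tau> * 1"
      using v by (intro mult_left_mono) auto
    also have "\<dots> \<le> 24 powr ?\<tau>" using golden_ratio_gt by (simp add: powr_mono2)
    finally have E: "s * (6 / (t * s)) powr ?\<tau> \<le> 24 powr ?\<tau>" .
    have "6 / (t * s) = 6 * t powr ?\<tau> / v" unfolding ts_eq by (simp add: powr_minus divide_simps)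
    also have "\<dots> \<le> 6 * t powr ?\<tau>" using v t by (simp add: divide_le_eq)
    also have "\<dots> \<le> 240 * t powr ?\<tau>" by simp
    finally have K: "6 / (t * s) \<le> 240 * t powr ?\<tau>" .
    have "6 / (t * s) * a = 6 / (b * \<bar>\<zeta> q\<bar>)" using a by (simp add: ts)
    then have "X x \<le> 6 / (t * s) * a" using x(3) b form_q_pos by (simp add: le_divide_eq)
    moreover have "\<bar>\<zeta> x\<bar> * a\<^sup>2 \<le> s" using x(4) by (simp add: s_def mult.commute[of "a\<^sup>2"] mult_right_mono)
    ultimately show thesis using x(1,2) E K t s by (intro ex[of x "6 / (t * s)" s]) auto
  qed
qed

end

theorem theorem3:
  fixes \<alpha>\<^sub>1 \<alpha>\<^sub>2 \<tau> :: real and m :: "nat \<Rightarrow> int ^ 3" and \<nu> :: nat and M :: "nat \<Rightarrow> real"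
  assumes indep: "lin_indep_Z3 1 \<alpha>\<^sub>1 \<alpha>\<^sub>2"
    and seq: "best_approximation_seq \<alpha>\<^sub>1 \<alpha>\<^sub>2 m"
    and M: "\<And>\<mu>. M \<mu> = of_int (height (m \<mu>))"
    and tau: "\<tau> = golden_ratio"
    and nu: "\<nu> \<ge> 2"
    and det: "det (vector [m (\<nu> - 1), m \<nu>, m (\<nu> + 1)] :: int ^ 3 ^ 3) \<noteq> 0"
  shows
    "(\<exists>x\<^sub>1 x\<^sub>2 :: int. x\<^sub>1 > 0 \<and> x\<^sub>2 > 0 \<and>
        M (\<nu> + 2) \<le> of_int (max x\<^sub>1 x\<^sub>2) \<and> of_int (max x\<^sub>1 x\<^sub>2) \<le> 4 * M (\<nu> + 2) \<and>
        dist_nearest_int (\<alpha>\<^sub>1 * of_int x\<^sub>1 + \<alpha>\<^sub>2 * of_int x\<^sub>2) \<le> 16 * of_int (max x\<^sub>1 x\<^sub>2) powi (-2))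
     \<or>
     (\<exists>x\<^sub>1 x\<^sub>2 :: int. x\<^sub>1 > 0 \<and> x\<^sub>2 > 0 \<and>
        of_int (max x\<^sub>1 x\<^sub>2) \<le> 240 * M (\<nu> + 1) powr \<tau> * M \<nu> powr (- 1 / \<tau>) \<and>
        dist_nearest_int (\<alpha>\<^sub>1 * of_int x\<^sub>1 + \<alpha>\<^sub>2 * of_int x\<^sub>2)
          \<le> 24 powr \<tau> * M \<nu> powr ((1 - \<tau>) / \<tau>) * of_int (max x\<^sub>1 x\<^sub>2) powr (- \<tau>))"
proof -
  have positive: "0 < height (m \<mu>)" if "1 \<le> \<mu>" for \<mu>
  proof -
    have "best_approximation \<alpha>\<^sub>1 \<alpha>\<^sub>2 (m \<mu>)" using seq that by (simp add: best_approximation_seq_def)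
    then show ?thesis by (rule best_approximation_height_pos)
  qed
  have increasing: "height (m \<mu>) < height (m (Suc \<mu>))" if "1 \<le> \<mu>" for \<mu>
    using seq that by (simp add: best_approximation_seq_def)
  \<comment> \<open>Dirichlet's bound requires height at least 2, which holds from the second term
    on.\<close>
  have two: "2 \<le> height (m (Suc \<mu>))" if "1 \<le> \<mu>" for \<mu>
    using positive[OF that] increasing[OF that] by simp
  have \<nu>: "1 \<le> \<nu> - 1" "1 \<le> \<nu>" "Suc (\<nu> - 1) = \<nu>" using nu by auto
  interpret independent_triple \<alpha>\<^sub>1 \<alpha>\<^sub>2 "m (\<nu> - 1)" "m \<nu>" "m (\<nu> + 1)"
  proof
    show "height (m (\<nu> - 1)) < height (m \<nu>)" "height (m \<nu>) < height (m (\<nu> + 1))"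
      using increasing[OF \<nu>(1)] increasing[OF \<nu>(2)] \<nu>(3) by simp_all
    show "\<bar>linear_form \<alpha>\<^sub>1 \<alpha>\<^sub>2 (m (\<nu> - 1))\<bar> * (real_of_int (height (m \<nu>)))\<^sup>2 \<le> 1"
      "\<bar>linear_form \<alpha>\<^sub>1 \<alpha>\<^sub>2 (m \<nu>)\<bar> * (real_of_int (height (m (\<nu> + 1))))\<^sup>2 \<le> 1"
      using best_approximation_seq_dirichlet[OF seq \<nu>(1) two[OF \<nu>(1)]]
        best_approximation_seq_dirichlet[OF seq \<nu>(2) two[OF \<nu>(2)]] \<nu>(3) by simp_all
    show "\<bar>linear_form \<alpha>\<^sub>1 \<alpha>\<^sub>2 (m (\<nu> + 1))\<bar> < \<bar>linear_form \<alpha>\<^sub>1 \<alpha>\<^sub>2 (m \<nu>)\<bar>"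
      using best_approximation_seq_decreasing[OF indep seq \<nu>(2) positive[OF \<nu>(2)]] by simp
    show "\<bar>linear_form \<alpha>\<^sub>1 \<alpha>\<^sub>2 (m \<nu>)\<bar> \<le> \<bar>linear_form \<alpha>\<^sub>1 \<alpha>\<^sub>2 x\<bar>"
      if "0 < height x" "height x < height (m (\<nu> + 1))" for x
      using best_approximation_seq_minimal[OF seq \<nu>(2), of "x $ 2" "x $ 3"] that
        dist_nearest_int_le_linear_form[of x \<alpha>\<^sub>1 \<alpha>\<^sub>2] unfolding height_def by simp
    show "det (vector [m (\<nu> - 1), m \<nu>, m (\<nu> + 1)] :: int ^ 3 ^ 3) \<noteq> 0" by (rule det)
  qed
  obtain x where x: "0 < x $ 2" "0 < x $ 3"
    "of_int (max (x $ 2) (x $ 3)) \<le> 240 * M (\<nu> + 1) powr \<tau> * M \<nu> powr (- 1 / \<tau>)"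
    "\<bar>linear_form \<alpha>\<^sub>1 \<alpha>\<^sub>2 x\<bar> \<le> 24 powr \<tau> * M \<nu> powr ((1 - \<tau>) / \<tau>) * of_int (max (x $ 2) (x $ 3)) powr (- \<tau>)"
    using positive_point_golden unfolding M tau by blast
  have "dist_nearest_int (\<alpha>\<^sub>1 * of_int (x $ 2) + \<alpha>\<^sub>2 * of_int (x $ 3)) \<le> \<bar>linear_form \<alpha>\<^sub>1 \<alpha>\<^sub>2 x\<bar>"
    using dist_nearest_int_le_linear_form[of x \<alpha>\<^sub>1 \<alpha>\<^sub>2] by (simp add: mult.commute)
  with x show ?thesis by (meson order_trans)
qed

end
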